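(* Every $\beta$-shift ($\beta>1$) is a rectangle exclusion shift.
   Context: $\beta$-shift. For $\beta>1$ let $n$ be the integer with $\beta\in(n-1,n]$ and let $h_\beta:[0,1)\to[0,1)$, $h_\beta(x)=\beta x\bmod 1$. Code orbits of $h_\beta$ with the "partition" of $[0,1]$ into the $n$ intervals cut at $\beta^{-1},2\beta^{-1},\dots,(n-1)\beta^{-1}$ (for $\beta\in(1,2]$: $I_0=[0,\beta^{-1}]$, $I_1=[\beta^{-1},1]$), labelled $0,\dots,n-1$. The one-sided $\beta$-shift is the subshift of $\{0,\dots,n-1\}^{\mathbb N}$ given by (the closure of) the set of all sequences which are the code of some orbit. The (two-sided) $\beta$-shift is the natural extension of the one-sided one, i.e. the set of bi-infinite sequences all of whose right tails belong to the one-sided $\beta$-shift. Exclusion subshift. $M$ is a compact $s$-dimensional Riemannian manifold ($s\ge 2$), $f:M\to M$ an Axiom A diffeomorphism with nonwandering set $\Lambda$. More generally $f$ may be a map which is a local diffeomorphism except on a singularity set consisting of a finite union of codimension one manifolds, and which admits a finite proper generating Markov partition; in particular the $n$-fold Bakers map of $[0,1]^2$ is allowed (for $n=2$: $f(x,y)=(2x\bmod 1,\,y/2)$ if $x\le 1/2$, and $(2x\bmod 1,\,(y+1)/2)$ otherwise). Fix a proper (each element is the closure of its interior) generating Markov partition; let $(\hat\Sigma,\sigma)$ be the resulting subshift of finite type and $\pi:\hat\Sigma\to M$ the coding projection. A hole is an open set $H\subset M$ with $H=\mathrm{int}(\overline H)$ whose boundary $\partial H=\overline H\setminus H$ is a finite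 union of topological $(s-1)$-dimensional spheres. $\Omega^*\subset\Lambda$ is the invariant set of points whose orbit (forward and backward) never falls in $H$; $\Omega$ is the set of nonwandering points of $f|_{\Omega^*}$. Put $\Sigma=\pi^{-1}(\Omega)$ with the convention: if $x\in\Omega$ lies on $\partial H$ and its preimage under $\pi$ is not unique, only those $t\in\pi^{-1}(x)$ are kept in $\Sigma$ for which there exist $x_j\notin\overline H$ with $x_j\to x$ and $t_j\in\pi^{-1}(x_j)$ with $t_j\to t$. Such a $\Sigma$ is called an exclusion subshift. Rectangle exclusion shift (RES): $M$ is two dimensional and $\partial H$ consists of a finite number of curves, each of which is a finite length piece of stable or unstable manifold of $f$; the corresponding exclusion subshift is a rectangle exclusion shift. *)

theory Defs
  imports "HOL-Analysis.Analysis"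
begin

subsection \<open>Beta-shifts\<close>

text \<open>For \<open>\<beta> > 1\<close>, the integer \<open>n\<close> with \<open>\<beta> \<in> (n - 1, n]\<close> is the ceiling of \<open>\<beta>\<close>.\<close>

definition beta_size :: "real \<Rightarrow> nat" where
  "beta_size \<beta> = nat \<lceil>\<beta>\<rceil>"

definition beta_map :: "real \<Rightarrow> real \<Rightarrow> real" where
  "beta_map \<beta> x = frac (\<beta> * x)"

text \<open>The pieces are closed, so that neighbouring ones share an endpoint and a point may have
  several codes; the \<open>min\<close> is only relevant for the last piece.\<close>

definition beta_piece :: "real \<Rightarrow> nat \<Rightarrow> real set" where
  "beta_piece \<beta> j = {real j / \<beta> .. min 1 (real (Suc j) / \<beta>)}"

definition beta_codes :: "real \<Rightarrow> (nat \<Rightarrow> nat) set" where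
  "beta_codes \<beta> = {t. \<exists>x\<in>{0..<1}. \<forall>k. t k < beta_size \<beta> \<and> (beta_map \<beta> ^^ k) x \<in> beta_piece \<beta> (t k)}"

text \<open>The closure is taken in the product topology of the discrete spaces \<^typ>\<open>nat\<close>.\<close>

definition one_sided_beta_shift :: "real \<Rightarrow> (nat \<Rightarrow> nat) set" where
  "one_sided_beta_shift \<beta> = closure (beta_codes \<beta>)"

definition beta_shift :: "real \<Rightarrow> (int \<Rightarrow> nat) set" where
  "beta_shift \<beta> = {t. \<forall>k. (\<lambda>i. t (k + int i)) \<in> one_sided_beta_shift \<beta>}"


subsection \<open>Compact manifolds and local diffeomorphisms\<close>

text \<open>Manifolds are smooth submanifolds of a Euclidean space. For compact manifolds this is no
  restriction (Whitney), and the choice of a Riemannian metric is immaterial: on a compact manifold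
  every Riemannian distance is locally comparable to the Euclidean one, and nothing
  below depends on more than that. Boundary and corners are permitted, since the square
  \<open>[0,1]\<^sup>2\<close> has to be an admissible phase space.\<close>

primrec Ck_on :: "nat \<Rightarrow> 'a::real_normed_vector set \<Rightarrow> ('a \<Rightarrow> 'b::real_normed_vector) \<Rightarrow> bool" where
  "Ck_on 0 U g \<longleftrightarrow> continuous_on U g"
| "Ck_on (Suc k) U g \<longleftrightarrow>
     (\<forall>x\<in>U. g differentiable (at x)) \<and> (\<forall>v. Ck_on k U (\<lambda>x. frechet_derivative g (at x) v))"

definition diffeo_between :: "'a::euclidean_space set \<Rightarrow> 'a set \<Rightarrow> ('a \<Rightarrow> 'a) \<Rightarrow> bool" where
  "diffeo_between U V \<phi> \<longleftrightarrow> open U \<and> open V \<and>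
     (\<exists>\<psi>. homeomorphism U V \<phi> \<psi> \<and> (\<forall>k. Ck_on k U \<phi> \<and> Ck_on k V \<psi>))"

text \<open>The local models are \<open>s\<close>-dimensional coordinate subspaces (spanned by \<open>B\<close>) cut by the
  half-spaces of the coordinates in \<open>C\<close>.\<close>

definition submanifold :: "nat \<Rightarrow> 'a::euclidean_space set \<Rightarrow> bool" where
  "submanifold s M \<longleftrightarrow>
     (\<forall>x\<in>M. \<exists>U V \<phi> B C. x \<in> U \<and> diffeo_between U V \<phi> \<and> C \<subseteq> B \<and> B \<subseteq> Basis \<and> card B = s \<and>
        \<phi> ` (M \<inter> U) = V \<inter> {v. (\<forall>b\<in>Basis - B. v \<bullet> b = 0) \<and> (\<forall>b\<in>C. 0 \<le> v \<bullet> b)})"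

text \<open>A diffeomorphism between relatively open subsets of \<open>M\<close>
  extends, locally, to a diffeomorphism between open subsets of the ambient space.\<close>

definition local_diffeo_at :: "'a::euclidean_space set \<Rightarrow> ('a \<Rightarrow> 'a) \<Rightarrow> 'a \<Rightarrow> bool" where
  "local_diffeo_at M f x \<longleftrightarrow>
     (\<exists>U V g. x \<in> U \<and> diffeo_between U V g \<and> g ` (M \<inter> U) = M \<inter> V \<and> (\<forall>y\<in>M \<inter> U. f y = g y))"

text \<open>The singularity set may contain pieces of the boundary of \<open>M\<close>; for the Bakers maps it consists
  of the sides of the square and the lines of discontinuity. The case \<open>S = {}\<close> is that of a local
  diffeomorphism.\<close>

definition piecewise_local_diffeo :: "nat \<Rightarrow> 'a::euclidean_space set \<Rightarrow> ('a \<Rightarrow> 'a) \<Rightarrow> 'a set \<Rightarrow> bool" where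
  "piecewise_local_diffeo s M f S \<longleftrightarrow>
     f ` M \<subseteq> M \<and> (\<forall>x\<in>M - S. local_diffeo_at M f x) \<and>
     (\<exists>\<T>. finite \<T> \<and> S = \<Union>\<T> \<and> (\<forall>T\<in>\<T>. T \<subseteq> M \<and> compact T \<and> submanifold (s - 1) T))"


subsection \<open>Nonwandering sets and Markov partitions\<close>

definition nonwandering :: "'a::topological_space set \<Rightarrow> ('a \<Rightarrow> 'a) \<Rightarrow> 'a set" where
  "nonwandering X f = {x \<in> X. \<forall>U. open U \<and> x \<in> U \<longrightarrow> (\<exists>k>0. (f ^^ k) ` (X \<inter> U) \<inter> U \<noteq> {})}"

text \<open>Below, \<open>L\<close> is the nonwandering set, \<open>S\<close> the singularity set, and \<open>R i\<close>, for labels \<open>i \<in> A\<close>, are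
  the elements of a partition. Interiors are relative to \<open>L\<close>. Only points
  off \<open>S\<close> are used for coding, as the values of the map on \<open>S\<close> carry no information;
  all other points are reached by taking closures.\<close>

definition regular_part :: "'a::topological_space set \<Rightarrow> 'a set \<Rightarrow> (nat \<Rightarrow> 'a set) \<Rightarrow> nat \<Rightarrow> 'a set" where
  "regular_part L S R i = ((top_of_set L) interior_of (R i)) - S"

definition transition ::
  "('a::topological_space \<Rightarrow> 'a) \<Rightarrow> 'a set \<Rightarrow> 'a set \<Rightarrow> (nat \<Rightarrow> 'a set) \<Rightarrow> nat \<Rightarrow> nat \<Rightarrow> bool" where
  "transition f L S R i j \<longleftrightarrow> (\<exists>z. z \<in> regular_part L S R i \<and> f z \<in> regular_part L S R j)"

definition coding_sft ::
  "('a::topological_space \<Rightarrow> 'a) \<Rightarrow> 'a set \<Rightarrow> 'a set \<Rightarrow> nat set \<Rightarrow> (nat \<Rightarrow> 'a set) \<Rightarrow> (int \<Rightarrow> nat) set" where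
  "coding_sft f L S A R = {t. \<forall>k. t k \<in> A \<and> transition f L S R (t k) (t (k + 1))}"

text \<open>The points with itinerary \<open>t\<close> from time \<open>- m\<close> to time \<open>m\<close>; \<open>z\<close> is the point of the
  orbit at time \<open>- m\<close>.\<close>

definition cylinder ::
  "('a::topological_space \<Rightarrow> 'a) \<Rightarrow> 'a set \<Rightarrow> 'a set \<Rightarrow> (nat \<Rightarrow> 'a set) \<Rightarrow> (int \<Rightarrow> nat) \<Rightarrow> nat \<Rightarrow> 'a set" where
  "cylinder f L S R t m =
     {(f ^^ m) z | z. \<forall>j\<le>2 * m. (f ^^ j) z \<in> regular_part L S R (t (int j - int m))}"

definition proper_partition ::
  "'a::topological_space set \<Rightarrow> nat set \<Rightarrow> (nat \<Rightarrow> 'a set) \<Rightarrow> bool" where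
  "proper_partition L A R \<longleftrightarrow> finite A \<and> (\<Union>i\<in>A. R i) = L \<and>
     (\<forall>i\<in>A. R i = (top_of_set L) closure_of ((top_of_set L) interior_of (R i))) \<and>
     (\<forall>i\<in>A. \<forall>j\<in>A. i \<noteq> j \<longrightarrow>
        ((top_of_set L) interior_of (R i)) \<inter> ((top_of_set L) interior_of (R j)) = {})"

text \<open>Markov partitions in the sense of Adler and Lind--Marcus, which does not presuppose
  that \<open>f\<close> is continuous: every word of allowed transitions is realised by an orbit segment, and
  the partition generates, i.e. the closed cylinders of a sequence shrink to one point.\<close>

definition generating_markov_partition ::
  "('a::topological_space \<Rightarrow> 'a) \<Rightarrow> 'a set \<Rightarrow> 'a set \<Rightarrow> nat set \<Rightarrow> (nat \<Rightarrow> 'a set) \<Rightarrow> bool" where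
  "generating_markov_partition f L S A R \<longleftrightarrow>
     proper_partition L A R \<and>
     (\<forall>n w. (\<forall>k\<le>n. w k \<in> A) \<and> (\<forall>k<n. transition f L S R (w k) (w (Suc k))) \<longrightarrow>
        (\<exists>z. \<forall>k\<le>n. (f ^^ k) z \<in> regular_part L S R (w k))) \<and>
     (\<forall>t\<in>coding_sft f L S A R. \<exists>x. (\<Inter>m. closure (cylinder f L S R t m)) = {x})"

definition coding_map ::
  "('a::topological_space \<Rightarrow> 'a) \<Rightarrow> 'a set \<Rightarrow> 'a set \<Rightarrow> (nat \<Rightarrow> 'a set) \<Rightarrow> (int \<Rightarrow> nat) \<Rightarrow> 'a" where
  "coding_map f L S R t = (THE x. (\<Inter>m. closure (cylinder f L S R t m)) = {x})"


subsection \<open>Exclusion subshifts\<close>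

definition topological_sphere :: "nat \<Rightarrow> 'a::euclidean_space set \<Rightarrow> bool" where
  "topological_sphere d C \<longleftrightarrow> (\<exists>B\<subseteq>Basis. card B = Suc d \<and> C homeomorphic (sphere (0::'a) 1 \<inter> span B))"

text \<open>\<open>M\<close> is closed, so \<open>closure H\<close> is also the closure in \<open>M\<close>.\<close>

definition hole :: "nat \<Rightarrow> 'a::euclidean_space set \<Rightarrow> 'a set \<Rightarrow> bool" where
  "hole s M H \<longleftrightarrow> openin (top_of_set M) H \<and> H = (top_of_set M) interior_of (closure H) \<and>
     (\<exists>\<C>. finite \<C> \<and> closure H - H = \<Union>\<C> \<and> (\<forall>C\<in>\<C>. topological_sphere (s - 1) C))"

text \<open>An Axiom A diffeomorphism of a compact manifold, with the (Bowen) Markov partition of its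
  nonwandering set, is the case \<open>S = {}\<close>.\<close>

definition exclusion_system ::
  "nat \<Rightarrow> 'a::euclidean_space set \<Rightarrow> ('a \<Rightarrow> 'a) \<Rightarrow> 'a set \<Rightarrow> nat set \<Rightarrow> (nat \<Rightarrow> 'a set) \<Rightarrow> 'a set \<Rightarrow> bool" where
  "exclusion_system s M f S A R H \<longleftrightarrow>
     2 \<le> s \<and> compact M \<and> submanifold s M \<and> piecewise_local_diffeo s M f S \<and>
     generating_markov_partition f (nonwandering M f) S A R \<and> hole s M H"

text \<open>As \<open>f\<close> need not be injective on the singularity set, \<open>x\<close> is required to lie on some two-sided
  orbit in \<open>L - H\<close>; this gives the largest \<open>X \<subseteq> L - H\<close> with \<open>f ` X = X\<close>.\<close>

definition avoiding_set :: "'a set \<Rightarrow> ('a \<Rightarrow> 'a) \<Rightarrow> 'a set \<Rightarrow> 'a set" where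
  "avoiding_set L f H = {x. \<exists>p :: int \<Rightarrow> 'a. p 0 = x \<and> (\<forall>k. p k \<in> L - H \<and> f (p k) = p (k + 1))}"

definition exclusion_shift ::
  "'a::euclidean_space set \<Rightarrow> ('a \<Rightarrow> 'a) \<Rightarrow> 'a set \<Rightarrow> nat set \<Rightarrow> (nat \<Rightarrow> 'a set) \<Rightarrow> 'a set \<Rightarrow> (int \<Rightarrow> nat) set" where
  "exclusion_shift M f S A R H =
     (let L = nonwandering M f;
          \<Omega> = nonwandering (avoiding_set L f H) f;
          \<Sigma>' = coding_sft f L S A R;
          \<pi> = coding_map f L S R
      in {t \<in> \<Sigma>'. \<pi> t \<in> \<Omega> \<and>
           (\<pi> t \<in> closure H - H \<and> (\<exists>t'\<in>\<Sigma>'. t' \<noteq> t \<and> \<pi> t' = \<pi> t) \<longrightarrow>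
              (\<exists>u :: nat \<Rightarrow> int \<Rightarrow> nat. (\<forall>j. u j \<in> \<Sigma>' \<and> \<pi> (u j) \<notin> closure H) \<and>
                 u \<longlonglongrightarrow> t \<and> (\<lambda>j. \<pi> (u j)) \<longlonglongrightarrow> \<pi> t))})"


subsection \<open>Rectangle exclusion shifts\<close>

definition stable_set :: "'a::metric_space set \<Rightarrow> ('a \<Rightarrow> 'a) \<Rightarrow> 'a \<Rightarrow> 'a set" where
  "stable_set M f x = {y \<in> M. (\<lambda>k. dist ((f ^^ k) x) ((f ^^ k) y)) \<longlonglongrightarrow> 0}"

definition unstable_set :: "'a::metric_space set \<Rightarrow> ('a \<Rightarrow> 'a) \<Rightarrow> 'a \<Rightarrow> 'a set" where
  "unstable_set M f x = {y. \<exists>p q :: nat \<Rightarrow> 'a. p 0 = x \<and> q 0 = y \<and>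
     (\<forall>k. p k \<in> M \<and> q k \<in> M \<and> f (p (Suc k)) = p k \<and> f (q (Suc k)) = q k) \<and>
     (\<lambda>k. dist (p k) (q k)) \<longlonglongrightarrow> 0}"

definition finite_length :: "(real \<Rightarrow> 'a::metric_space) \<Rightarrow> bool" where
  "finite_length \<gamma> \<longleftrightarrow> (\<exists>K. \<forall>n (r :: nat \<Rightarrow> real).
     (\<forall>i\<le>n. r i \<in> {0..1}) \<and> (\<forall>i<n. r i \<le> r (Suc i)) \<longrightarrow>
     (\<Sum>i<n. dist (\<gamma> (r i)) (\<gamma> (r (Suc i)))) \<le> K)"

text \<open>On a surface, the stable and unstable manifolds in question are curves; the condition of empty
  interior excludes the two-dimensional basins of sinks and sources, in which any curve
  whatsoever would qualify.\<close>

definition invariant_manifold_piece :: "'a::euclidean_space set \<Rightarrow> ('a \<Rightarrow> 'a) \<Rightarrow> (real \<Rightarrow> 'a) \<Rightarrow> bool" where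
  "invariant_manifold_piece M f \<gamma> \<longleftrightarrow> arc \<gamma> \<and> finite_length \<gamma> \<and>
     (\<exists>x\<in>nonwandering M f. \<exists>W\<in>{stable_set M f x, unstable_set M f x}.
        (top_of_set M) interior_of W = {} \<and> path_image \<gamma> \<subseteq> W)"

text \<open>Every compact surface embeds in \<open>\<real>\<^sup>5\<close>, so fixing this ambient space loses no
  generality.\<close>

definition rectangle_exclusion_shift :: "(int \<Rightarrow> nat) set \<Rightarrow> bool" where
  "rectangle_exclusion_shift \<Sigma> \<longleftrightarrow>
     (\<exists>(M :: (real ^ 5) set) f S A R H. exclusion_system 2 M f S A R H \<and>
        (\<exists>\<Gamma>. finite \<Gamma> \<and> closure H - H = (\<Union>\<gamma>\<in>\<Gamma>. path_image \<gamma>) \<and>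
           (\<forall>\<gamma>\<in>\<Gamma>. invariant_manifold_piece M f \<gamma>)) \<and>
        \<Sigma> = exclusion_shift M f S A R H)"

end

theory Submission
  imports Defs
begin

text \<open>With \<open>\<omega>\<close> the quasi-greedy \<open>\<beta>\<close>-expansion of 1, Parry's criterion says that the one-sided
  \<open>\<beta>\<close>-shift consists of the sequences all of whose shifts are lexicographically at most \<open>\<omega>\<close>. For
  \<open>n = \<lceil>\<beta>\<rceil>\<close>, the system is the \<open>N\<close>-fold Bakers map of the unit square with \<open>N = n + 2\<close>: the
  digits \<open>0, \<dots>, n - 1\<close> label the strips \<open>1, \<dots>, n\<close>, and the two outermost strips are spare. The
  hole is the complement in the square of a rectangle in its interior whose left, lower and upper
  sides lie on invariant manifolds of fixed points and whose right side lies over the point with base-\<open>N\<close> digits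
  \<open>\<omega> + 1\<close>. Orbits that stay in the rectangle have all their digits in \<open>{1..n}\<close>, and since base-\<open>N\<close>
  expansions with such digits are strictly monotone for the lexicographic order, they are exactly
  those coded by the \<open>\<beta>\<close>-shift.

  The spare strips keep the boundary of the hole away from the sides of the square, so that it is
  one circle, and make the coding injective off the hole. The Bakers map is given the
  value 0, a point of the hole, on its singularity set, so that no orbit avoiding the hole is singular.\<close>

subsection \<open>Lexicographic description of beta-shifts\<close>

text \<open>Two parts of the definition of an exclusion subshift might discard admissible sequences.
  The first is the passage to nonwandering points. Nothing is lost there because admissible words
  can be made to recur after a block of 1s; this rests on the quasi-greedy \<omega> never ending in
  zeros, so that the bound has entries at least 2 arbitrarily far out. The second is the boundary
  convention, and it keeps everything because a point whose orbit avoids the hole has a single code.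
  The sides of the rectangle have to lie in stable or unstable sets without interior. A vertical
  segment over any sequence of inner digits contracts forwards, which allows the possibly aperiodic
  sequence \<omega> + 1 on the right side; a horizontal segment at a fixed height contracts
  backwards along one inverse branch. Empty interior comes from the dense set of points with N-adic
  coordinates: forwards they are absorbed by 0, and those of positive height have no infinite
  backward orbit.\<close>

definition lex_le :: "(nat \<Rightarrow> nat) \<Rightarrow> (nat \<Rightarrow> nat) \<Rightarrow> bool" where
  "lex_le s u \<longleftrightarrow> s = u \<or> (\<exists>j. (\<forall>i<j. s i = u i) \<and> s j < u j)"

text \<open>The first place of disagreement decides. A failure of the order is thus visible on a
  finite prefix, which makes lexicographic conditions closed.\<close>

lemma not_lex_le: "\<not> lex_le s u \<longleftrightarrow> (\<exists>j. (\<forall>i<j. s i = u i) \<and> u j < s j)"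
proof
  assume nl: "\<not> lex_le s u"
  define j where "j = (LEAST j. s j \<noteq> u j)"
  have "\<exists>j. s j \<noteq> u j" using nl unfolding lex_le_def by blast
  then have "s j \<noteq> u j" unfolding j_def by (rule LeastI_ex)
  moreover have "\<forall>i<j. s i = u i" using not_less_Least j_def by blast
  ultimately show "\<exists>j. (\<forall>i<j. s i = u i) \<and> u j < s j"
    using nl unfolding lex_le_def by (metis nat_neq_iff)
next
  assume "\<exists>j. (\<forall>i<j. s i = u i) \<and> u j < s j"
  then obtain j where j: "\<forall>i<j. s i = u i" "u j < s j" by blast
  show "\<not> lex_le s u"
  proof
    assume "lex_le s u"
    then obtain k where k: "\<forall>i<k. s i = u i" "s k < u k"
      using j unfolding lex_le_def by auto
    show False using j k by (metis less_asym nat_neq_iff)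
  qed
qed

lemma lex_leD: "lex_le s u \<Longrightarrow> s 0 < u 0 \<or> s 0 = u 0 \<and> lex_le (\<lambda>i. s (Suc i)) (\<lambda>i. u (Suc i))"
proof (rule ccontr)
  assume le: "lex_le s u" and "\<not> ?thesis"
  then consider "u 0 < s 0" | "s 0 = u 0" "\<not> lex_le (\<lambda>i. s (Suc i)) (\<lambda>i. u (Suc i))"
    by fastforce
  then have "\<not> lex_le s u"
  proof cases
    case 1
    then show ?thesis unfolding not_lex_le by (intro exI[of _ 0]) simp
  next
    case 2
    then obtain j where "\<forall>i<j. s (Suc i) = u (Suc i)" "u (Suc j) < s (Suc j)"
      unfolding not_lex_le by blast
    with 2(1) show ?thesis
      unfolding not_lex_le by (intro exI[of _ "Suc j"]) (auto simp: less_Suc_eq_0_disj)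
  qed
  with le show False by blast
qed

lemma lex_le_head: "lex_le s u \<Longrightarrow> s 0 \<le> u 0"
  using lex_leD[of s u] by auto

text \<open>The factors are discrete, so prefix cylinders form a neighbourhood base of the product
  topology.\<close>

lemma closure_prefix:
  fixes C :: "(nat \<Rightarrow> nat) set"
  shows "t \<in> closure C \<longleftrightarrow> (\<forall>m. \<exists>s\<in>C. \<forall>i<m. s i = t i)"
proof
  assume t: "t \<in> closure C"
  show "\<forall>m. \<exists>s\<in>C. \<forall>i<m. s i = t i"
  proof
    fix m
    let ?U = "\<Pi>\<^sub>E i\<in>UNIV. if i < m then {t i} else UNIV"
    have "open ?U"
      by (intro open_PiE) (auto simp: open_discrete)
    moreover have "t \<in> ?U" by auto
    ultimately obtain s where "s \<in> C" "s \<in> ?U"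
      using t by (meson closure_iff_nhds_not_empty disjoint_iff order_refl)
    then show "\<exists>s\<in>C. \<forall>i<m. s i = t i"
      by (intro bexI[of _ s]) (auto simp: PiE_iff split: if_splits)
  qed
next
  assume *: "\<forall>m. \<exists>s\<in>C. \<forall>i<m. s i = t i"
  then obtain s where s: "\<And>m. s m \<in> C" "\<And>m i. i < m \<Longrightarrow> s m i = t i"
    by metis
  have "s \<longlonglongrightarrow> t"
  proof (intro limitin_canonical_iff[THEN iffD1] , unfold euclidean_product_topology[symmetric] limitin_componentwise, intro conjI ballI)
    show "t \<in> extensional UNIV" by simp
    show "\<forall>\<^sub>F x in sequentially. s x \<in> topspace (product_topology (\<lambda>i. euclidean) UNIV)"
      by simp
    fix i :: nat
    have "\<forall>\<^sub>F m in sequentially. s m i = t i"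
      using eventually_gt_at_top[of i] by eventually_elim (rule s(2))
    then have "(\<lambda>m. s m i) \<longlonglongrightarrow> t i" by (rule tendsto_eventually)
    then show "limitin euclidean (\<lambda>m. s m i) (t i) sequentially"
      by simp
  qed
  then show "t \<in> closure C"
    using s(1) closure_sequential by blast
qed

section \<open>Quasi-greedy expansion of 1 and Parry's criterion\<close>

primrec expansion_rem :: "real \<Rightarrow> nat \<Rightarrow> real" where
  "expansion_rem \<beta> 0 = 1"
| "expansion_rem \<beta> (Suc k) = \<beta> * expansion_rem \<beta> k - of_int (\<lceil>\<beta> * expansion_rem \<beta> k\<rceil> - 1)"

text \<open>Ceiling minus one in place of the floor keeps the remainders in (0, 1] instead of [0,
  1). The expansion therefore never terminates: where the greedy algorithm would first reach the
  remainder 0, this one reaches 1 and starts again.\<close>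

definition quasi_greedy :: "real \<Rightarrow> nat \<Rightarrow> nat" where
  "quasi_greedy \<beta> k = nat (\<lceil>\<beta> * expansion_rem \<beta> k\<rceil> - 1)"

lemma expansion_rem_bounds:
  assumes "1 < \<beta>"
  shows "0 < expansion_rem \<beta> k" "expansion_rem \<beta> k \<le> 1"
proof -
  have "0 < expansion_rem \<beta> k \<and> expansion_rem \<beta> k \<le> 1"
  proof (cases k)
    case (Suc k)
    then show ?thesis by (simp; linarith)
  qed simp
  then show "0 < expansion_rem \<beta> k" "expansion_rem \<beta> k \<le> 1" by auto
qed

lemma real_quasi_greedy:
  assumes "1 < \<beta>"
  shows "real (quasi_greedy \<beta> k) = \<beta> * expansion_rem \<beta> k - expansion_rem \<beta> (Suc k)"
proof -
  have "0 < \<beta> * expansion_rem \<beta> k"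
    using assms expansion_rem_bounds(1)[OF assms, of k] by simp
  then have "1 \<le> \<lceil>\<beta> * expansion_rem \<beta> k\<rceil>" by linarith
  then show ?thesis by (simp add: quasi_greedy_def)
qed

lemma quasi_greedy_0: "1 < \<beta> \<Longrightarrow> quasi_greedy \<beta> 0 = beta_size \<beta> - 1"
  by (simp add: quasi_greedy_def beta_size_def nat_diff_distrib)

lemma beta_size_ge_2: "1 < \<beta> \<Longrightarrow> 2 \<le> beta_size \<beta>"
  unfolding beta_size_def by linarith

lemma quasi_greedy_less:
  assumes "1 < \<beta>"
  shows "quasi_greedy \<beta> k < beta_size \<beta>"
proof -
  have "\<beta> * expansion_rem \<beta> k \<le> \<beta>"
    using assms expansion_rem_bounds[OF assms, of k] by simp
  then have "\<lceil>\<beta> * expansion_rem \<beta> k\<rceil> \<le> \<lceil>\<beta>\<rceil>" by (rule ceiling_mono)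
  moreover have "0 < \<lceil>\<beta>\<rceil>" using assms by simp
  ultimately show ?thesis unfolding quasi_greedy_def beta_size_def by linarith
qed

text \<open>Zero digits from \<open>k\<close> on would multiply the positive remainder by \<beta> at
  each step and push it beyond 1.\<close>

lemma quasi_greedy_nonzero:
  assumes "1 < \<beta>"
  shows "\<exists>i\<ge>k. quasi_greedy \<beta> i \<noteq> 0"
proof (rule ccontr)
  assume "\<not> ?thesis"
  then have z: "\<And>i. k \<le> i \<Longrightarrow> quasi_greedy \<beta> i = 0" by blast
  have *: "expansion_rem \<beta> (k + i) = \<beta> ^ i * expansion_rem \<beta> k" for i
  proof (induction i)
    case (Suc i)
    then show ?case using real_quasi_greedy[OF assms, of "k + i"] z[of "k + i"]
      by (simp del: expansion_rem.simps)
  qed simp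
  obtain i where "1 / expansion_rem \<beta> k < \<beta> ^ i"
    using real_arch_pow[OF assms] by blast
  then have "1 < expansion_rem \<beta> (k + i)"
    using expansion_rem_bounds(1)[OF assms, of k] by (simp add: * divide_less_eq)
  then show False using expansion_rem_bounds(2)[OF assms, of "k + i"] by simp
qed

text \<open>The orbit starts strictly below the remainder 1 and stays strictly below the remainders
  as long as its digits agree with those of 1. Then \<open>s j < quasi_greedy \<beta> j + 1\<close>
  at the first disagreement.\<close>

lemma beta_code_lex_le:
  assumes b: "1 < \<beta>" and s: "s \<in> beta_codes \<beta>"
  shows "lex_le s (quasi_greedy \<beta>)"
proof (rule ccontr)
  assume "\<not> ?thesis"
  then obtain j where j: "\<forall>i<j. s i = quasi_greedy \<beta> i" "quasi_greedy \<beta> j < s j"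
    unfolding not_lex_le by blast
  obtain x where x: "0 \<le> x" "x < 1"
    and p: "\<And>k. (beta_map \<beta> ^^ k) x \<in> beta_piece \<beta> (s k)"
    using s unfolding beta_codes_def by auto
  define y where "y k = (beta_map \<beta> ^^ k) x" for k
  have y: "real (s k) \<le> \<beta> * y k" "\<beta> * y k \<le> real (s k) + 1" for k
    using p[of k] b unfolding y_def beta_piece_def by (auto simp: field_simps)
  \<comment> \<open>Only an inequality: at the right endpoint of a closed piece the orbit can go to
    0 while the right-hand side is 1.\<close>
  have y_Suc: "y (Suc k) \<le> \<beta> * y k - real (s k)" for k
  proof -
    have "y (Suc k) = frac (\<beta> * y k)" by (simp add: y_def beta_map_def)
    moreover have "int (s k) \<le> \<lfloor>\<beta> * y k\<rfloor>" using y(1)[of k] by linarith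
    ultimately show ?thesis unfolding frac_def by linarith
  qed
  have "k \<le> j \<Longrightarrow> y k < expansion_rem \<beta> k" for k
  proof (induction k)
    case 0
    then show ?case using x by (simp add: y_def)
  next
    case (Suc k)
    have "\<beta> * y k < \<beta> * expansion_rem \<beta> k" using Suc b by simp
    then show ?case
      using Suc.prems y_Suc[of k] real_quasi_greedy[OF b, of k] j(1) by (simp del: expansion_rem.simps)
  qed
  then have "\<beta> * y j < \<beta> * expansion_rem \<beta> j" using b by simp
  then have "real (s j) < real (quasi_greedy \<beta> j) + 1"
    using y(1)[of j] real_quasi_greedy[OF b, of j] expansion_rem_bounds(2)[OF b, of "Suc j"] by linarith
  then show False using j(2) by linarith
qed

lemma beta_codes_shift:
  assumes "1 < \<beta>" "s \<in> beta_codes \<beta>"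
  shows "(\<lambda>i. s (k + i)) \<in> beta_codes \<beta>"
proof -
  obtain x where x: "x \<in> {0..<1}"
    and p: "\<And>k. s k < beta_size \<beta> \<and> (beta_map \<beta> ^^ k) x \<in> beta_piece \<beta> (s k)"
    using assms unfolding beta_codes_def by auto
  have "(beta_map \<beta> ^^ k) x \<in> {0..<1}"
    using x by (cases k) (auto simp: beta_map_def frac_lt_1)
  moreover have "(beta_map \<beta> ^^ i) ((beta_map \<beta> ^^ k) x) = (beta_map \<beta> ^^ (k + i)) x" for i
    by (metis add.commute comp_apply funpow_add)
  ultimately show ?thesis
    unfolding beta_codes_def using p by (auto intro!: bexI[of _ "(beta_map \<beta> ^^ k) x"])
qed

text \<open>The partial sum \<open>u 0 / \<beta> + ... + u (l - 1) / \<beta> ^ l\<close> in Horner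
  form, so that dropping a digit is one step of the recursion.\<close>

primrec prefix_value :: "real \<Rightarrow> nat \<Rightarrow> (nat \<Rightarrow> nat) \<Rightarrow> real" where
  "prefix_value \<beta> 0 u = 0"
| "prefix_value \<beta> (Suc l) u = (real (u 0) + prefix_value \<beta> l (\<lambda>i. u (Suc i))) / \<beta>"

lemma prefix_value_nonneg: "1 < \<beta> \<Longrightarrow> 0 \<le> prefix_value \<beta> l u"
  by (induction l arbitrary: u) auto

text \<open>Comparing with an arbitrary tail of the expansion of 1 makes the induction work. An
  equal first digit leads on to the next remainder; a smaller one gains a whole unit, and the
  comparison restarts at \<open>expansion_rem \<beta> 0 = 1\<close>.\<close>

lemma prefix_value_less_rem:
  assumes b: "1 < \<beta>"
    and "\<And>k. lex_le (\<lambda>i. u (k + i)) (quasi_greedy \<beta>)"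
    and "lex_le u (\<lambda>i. quasi_greedy \<beta> (j + i))"
  shows "prefix_value \<beta> l u < expansion_rem \<beta> j"
  using assms(2,3)
proof (induction l arbitrary: u j)
  case 0
  then show ?case using expansion_rem_bounds[OF b] by simp
next
  case (Suc l)
  let ?v = "\<lambda>i. u (Suc i)"
  have v: "lex_le (\<lambda>i. ?v (k + i)) (quasi_greedy \<beta>)" for k
    using Suc.prems(1)[of "Suc k"] by simp
  have "real (u 0) + prefix_value \<beta> l ?v < \<beta> * expansion_rem \<beta> j"
    using lex_leD[OF Suc.prems(2)]
  proof
    assume "u 0 < quasi_greedy \<beta> (j + 0)"
    then have "real (u 0) + 1 \<le> quasi_greedy \<beta> j" by simp
    moreover have "prefix_value \<beta> l ?v < expansion_rem \<beta> 0"
      using v[of 0] by (intro Suc.IH v) simp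
    ultimately show ?thesis
      using real_quasi_greedy[OF b, of j] expansion_rem_bounds(1)[OF b, of "Suc j"] by simp
  next
    assume *: "u 0 = quasi_greedy \<beta> (j + 0) \<and> lex_le ?v (\<lambda>i. quasi_greedy \<beta> (j + Suc i))"
    then have "prefix_value \<beta> l ?v < expansion_rem \<beta> (Suc j)"
      by (intro Suc.IH v) simp
    then show ?thesis
      using * real_quasi_greedy[OF b, of j] by simp
  qed
  then show ?case using b by (simp add: divide_less_eq mult.commute)
qed

lemma one_sided_beta_shift_eq:
  assumes b: "1 < \<beta>"
  shows "one_sided_beta_shift \<beta> = {t. \<forall>k. lex_le (\<lambda>i. t (k + i)) (quasi_greedy \<beta>)}"
proof (intro set_eqI iffI; unfold mem_Collect_eq)
  fix t assume t: "t \<in> one_sided_beta_shift \<beta>"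
  show "\<forall>k. lex_le (\<lambda>i. t (k + i)) (quasi_greedy \<beta>)"
  proof (rule ccontr)
    assume "\<not> ?thesis"
    then obtain k where "\<not> lex_le (\<lambda>i. t (k + i)) (quasi_greedy \<beta>)" by blast
    then obtain j where kj: "\<forall>i<j. t (k + i) = quasi_greedy \<beta> i" "quasi_greedy \<beta> j < t (k + j)"
      unfolding not_lex_le by blast
    \<comment> \<open>A code that agrees with \<open>t\<close> up to position \<open>k + j\<close>
      inherits the violation.\<close>
    obtain s where s: "s \<in> beta_codes \<beta>" "\<forall>i<Suc (k + j). s i = t i"
      using t unfolding one_sided_beta_shift_def closure_prefix by blast
    have "\<not> lex_le (\<lambda>i. s (k + i)) (quasi_greedy \<beta>)"
      unfolding not_lex_le using kj s(2) by (intro exI[of _ j]) auto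
    then show False
      using beta_code_lex_le[OF b beta_codes_shift[OF b s(1)]] by blast
  qed
next
  fix t assume t: "\<forall>k. lex_le (\<lambda>i. t (k + i)) (quasi_greedy \<beta>)"
  show "t \<in> one_sided_beta_shift \<beta>"
    unfolding one_sided_beta_shift_def closure_prefix
  proof
    fix m
    \<comment> \<open>Truncation matters: a finite prefix has value strictly below 1, whereas
      \<open>t\<close> itself may have value 1, as the expansion of 1 does, and then codes no point
      of [0, 1).\<close>
    define s where "s i = (if i < m then t i else 0)" for i
    define x where "x k = prefix_value \<beta> (m - k) (\<lambda>i. t (k + i))" for k
    have x: "0 \<le> x k" "x k < 1" for k
    proof -
      show "0 \<le> x k" unfolding x_def using b by (rule prefix_value_nonneg)
      have "lex_le (\<lambda>i. t (k + (l + i))) (quasi_greedy \<beta>)" for l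
        using t[rule_format, of "k + l"] by (simp add: add.assoc)
      moreover have "lex_le (\<lambda>i. t (k + i)) (\<lambda>i. quasi_greedy \<beta> (0 + i))"
        using t by simp
      ultimately have "x k < expansion_rem \<beta> 0"
        unfolding x_def by (rule prefix_value_less_rem[OF b])
      then show "x k < 1" by simp
    qed
    have x_Suc: "\<beta> * x k = real (s k) + x (Suc k)" for k
    proof (cases "k < m")
      case True
      then have "m - k = Suc (m - Suc k)" by simp
      then show ?thesis using True b by (simp add: x_def s_def)
    qed (simp add: x_def s_def)
    have orbit: "(beta_map \<beta> ^^ k) (x 0) = x k" for k
    proof (induction k)
      case (Suc k)
      have "frac (\<beta> * x k) = x (Suc k)"
        unfolding x_Suc using x[of "Suc k"] by (simp add: frac_unique_iff)
      then show ?case using Suc by (simp add: beta_map_def)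
    qed simp
    have "s k < beta_size \<beta>" for k
      using lex_le_head[OF t[rule_format, of k]] quasi_greedy_less[OF b, of 0] beta_size_ge_2[OF b]
      by (auto simp: s_def)
    moreover have "x k \<in> beta_piece \<beta> (s k)" for k
      using x_Suc[of k] x[of "Suc k"] x(2)[of k] b
      unfolding beta_piece_def by (auto simp: field_simps)
    ultimately have "s \<in> beta_codes \<beta>"
      unfolding beta_codes_def using x[of 0] orbit by (auto intro!: bexI[of _ "x 0"])
    then show "\<exists>s\<in>beta_codes \<beta>. \<forall>i<m. s i = t i"
      by (rule bexI[rotated]) (simp add: s_def)
  qed
qed

lemma beta_shift_eq:
  assumes "1 < \<beta>"
  shows "beta_shift \<beta> = {t. \<forall>k. lex_le (\<lambda>i. t (k + int i)) (quasi_greedy \<beta>)}"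
proof (intro set_eqI iffI; unfold mem_Collect_eq)
  fix t assume "t \<in> beta_shift \<beta>"
  then have "lex_le (\<lambda>i. t (k + int (0 + i))) (quasi_greedy \<beta>)" for k
    unfolding beta_shift_def one_sided_beta_shift_eq[OF assms] by blast
  then show "\<forall>k. lex_le (\<lambda>i. t (k + int i)) (quasi_greedy \<beta>)" by simp
next
  fix t assume t: "\<forall>k. lex_le (\<lambda>i. t (k + int i)) (quasi_greedy \<beta>)"
  show "t \<in> beta_shift \<beta>"
    unfolding beta_shift_def one_sided_beta_shift_eq[OF assms]
    using t by (simp add: add.assoc[symmetric])
qed

subsection \<open>Base N digit expansions\<close>

definition digits :: "nat \<Rightarrow> (nat \<Rightarrow> nat) \<Rightarrow> bool" where
  "digits N s \<longleftrightarrow> (\<forall>i. s i < N)"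

definition digit_value :: "nat \<Rightarrow> (nat \<Rightarrow> nat) \<Rightarrow> real" where
  "digit_value N s = (\<Sum>i. real (s i) / real N ^ Suc i)"

context
  fixes N :: nat
  assumes N: "2 \<le> N"
begin

lemma digits_tail: "digits N s \<Longrightarrow> digits N (\<lambda>i. s (Suc i))"
  by (simp add: digits_def)

lemma sums_last_digit: "(\<lambda>i. real (N - 1) / real N ^ Suc i) sums 1"
proof -
  have "(\<lambda>i. (1 / real N) ^ i) sums (1 / (1 - 1 / real N))"
    using N by (intro geometric_sums) simp
  then have "(\<lambda>i. real (N - 1) / real N * (1 / real N) ^ i) sums
      (real (N - 1) / real N * (1 / (1 - 1 / real N)))"
    by (rule sums_mult)
  moreover have "real (N - 1) / real N * (1 / (1 - 1 / real N)) = 1"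
    using N by (simp add: field_simps of_nat_diff)
  moreover have "real (N - 1) / real N * (1 / real N) ^ i = real (N - 1) / real N ^ Suc i" for i
    by (simp add: power_divide)
  ultimately show ?thesis by (simp only:)
qed

lemma digit_term_le:
  assumes "digits N s"
  shows "real (s i) / real N ^ Suc i \<le> real (N - 1) / real N ^ Suc i"
proof -
  have "s i \<le> N - 1" using assms[unfolded digits_def, rule_format, of i] by linarith
  then show ?thesis by (intro divide_right_mono) auto
qed

lemma summable_digits: "digits N s \<Longrightarrow> summable (\<lambda>i. real (s i) / real N ^ Suc i)"
  by (rule summable_comparison_test'[OF sums_summable[OF sums_last_digit], of 0])
    (use digit_term_le in auto)

lemma digit_value_nonneg: "digits N s \<Longrightarrow> 0 \<le> digit_value N s"
  unfolding digit_value_def by (intro suminf_nonneg summable_digits) auto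

lemma digit_value_le_1:
  assumes "digits N s"
  shows "digit_value N s \<le> 1"
  unfolding digit_value_def sums_unique[OF sums_last_digit]
  by (intro suminf_le digit_term_le summable_digits assms sums_summable[OF sums_last_digit])

lemma digit_value_rec:
  assumes "digits N s"
  shows "digit_value N s = (real (s 0) + digit_value N (\<lambda>i. s (Suc i))) / real N"
proof -
  have "digit_value N s = (\<Sum>i. real (s (Suc i)) / real N ^ Suc (Suc i)) + real (s 0) / real N"
    unfolding digit_value_def using suminf_split_head[OF summable_digits[OF assms]] by simp
  moreover have "(\<Sum>i. real (s (Suc i)) / real N ^ Suc (Suc i)) = digit_value N (\<lambda>i. s (Suc i)) / real N"
    unfolding digit_value_def
    by (subst suminf_divide[OF summable_digits[OF digits_tail[OF assms]], symmetric]) (simp add: mult.commute)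
  ultimately show ?thesis by (simp add: add_divide_distrib)
qed

lemma digit_value_rec': "digits N s \<Longrightarrow> real N * digit_value N s = real (s 0) + digit_value N (\<lambda>i. s (Suc i))"
  using N by (simp add: digit_value_rec[of s])

lemma abs_le_inverse_power_Suc:
  fixes b :: real
  assumes "\<bar>real N * b\<bar> \<le> 1 / real N ^ m"
  shows "\<bar>b\<bar> \<le> 1 / real N ^ Suc m"
  using divide_right_mono[OF assms, of "real N"] N by (simp add: abs_mult mult.commute)

lemma digit_value_prefix:
  assumes "digits N s" "digits N s'" "\<And>i. i < m \<Longrightarrow> s i = s' i"
  shows "\<bar>digit_value N s - digit_value N s'\<bar> \<le> 1 / real N ^ m"
  using assms
proof (induction m arbitrary: s s')
  case 0
  then show ?case
    using digit_value_nonneg[of s] digit_value_nonneg[of s'] digit_value_le_1[of s] digit_value_le_1[of s']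
    by simp
next
  case (Suc m)
  have "\<bar>digit_value N (\<lambda>i. s (Suc i)) - digit_value N (\<lambda>i. s' (Suc i))\<bar> \<le> 1 / real N ^ m"
    using Suc.prems by (intro Suc.IH digits_tail) auto
  moreover have "digit_value N (\<lambda>i. s (Suc i)) - digit_value N (\<lambda>i. s' (Suc i)) =
      real N * (digit_value N s - digit_value N s')"
    using Suc.prems(3)[of 0]
    by (simp add: right_diff_distrib digit_value_rec'[OF Suc.prems(1)] digit_value_rec'[OF Suc.prems(2)])
  ultimately show ?case by (intro abs_le_inverse_power_Suc) simp
qed

lemma digit_value_pos:
  assumes "digits N s" "0 < s i"
  shows "0 < digit_value N s"
  unfolding digit_value_def
  by (rule suminf_pos2[OF summable_digits[OF assms(1)], of i]) (use assms N in auto)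

lemma digit_value_less_1:
  assumes "digits N s" "Suc (s i) < N"
  shows "digit_value N s < 1"
  using assms
proof (induction i arbitrary: s)
  case 0
  have "real (s 0) + 1 < real N" using 0 by linarith
  then have "real N * digit_value N s < real N * 1"
    using digit_value_le_1[OF digits_tail[OF 0(1)]] by (simp only: digit_value_rec'[OF 0(1)])
  then show ?case using N by simp
next
  case (Suc i)
  have "s 0 < N" using Suc.prems by (simp add: digits_def)
  then have "real (s 0) + 1 \<le> real N" by linarith
  then have "real N * digit_value N s < real N * 1"
    using Suc.IH[OF digits_tail[OF Suc.prems(1)]] Suc.prems(2) by (simp add: digit_value_rec'[OF Suc.prems(1)])
  then show ?case using N by simp
qed

text \<open>For 0 < j < N - 1 these values are the coordinates of the fixed points of the Bakers
  map; \<open>low\<close> and \<open>high\<close> below are the cases of the digits 1 and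
  \<open>N - 2\<close>.\<close>

lemma digit_value_const:
  assumes "j < N"
  shows "digit_value N (\<lambda>_. j) = real j / real (N - 1)"
  using digit_value_rec'[of "\<lambda>_. j"] assms N by (simp add: digits_def of_nat_diff field_simps)

lemma digit_value_mono:
  assumes "digits N s" "digits N s'" "\<And>i. s i \<le> s' i"
  shows "digit_value N s \<le> digit_value N s'"
  unfolding digit_value_def
  by (intro suminf_le summable_digits assms divide_right_mono) (auto simp: assms)

text \<open>Excluding the digit \<open>N - 1\<close> from \<open>s\<close> rules out pairs like
  0999... and 1000... with equal values: the tail of \<open>s\<close> after position
  \<open>j\<close> stays strictly below one unit.\<close>

lemma digit_value_lex_less:
  assumes "digits N s" "digits N s'" "\<And>i. Suc (s i) < N"
    and "\<forall>i<j. s i = s' i" "s j < s' j"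
  shows "digit_value N s < digit_value N s'"
  using assms
proof (induction j arbitrary: s s')
  case 0
  have "digit_value N (\<lambda>i. s (Suc i)) < 1"
    using digits_tail[OF 0(1)] 0(3) by (intro digit_value_less_1[where i=0])
  moreover have "0 \<le> digit_value N (\<lambda>i. s' (Suc i))"
    using digits_tail[OF 0(2)] by (rule digit_value_nonneg)
  moreover have "real (s 0) + 1 \<le> real (s' 0)" using 0(5) by linarith
  ultimately have "real N * digit_value N s < real N * digit_value N s'"
    unfolding digit_value_rec'[OF 0(1)] digit_value_rec'[OF 0(2)] by linarith
  then show ?case by (simp add: mult_less_cancel_left)
next
  case (Suc j)
  have "digit_value N (\<lambda>i. s (Suc i)) < digit_value N (\<lambda>i. s' (Suc i))"
    using Suc.prems by (intro Suc.IH digits_tail) auto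
  then have "real N * digit_value N s < real N * digit_value N s'"
    unfolding digit_value_rec'[OF Suc.prems(1)] digit_value_rec'[OF Suc.prems(2)] using Suc.prems(4) by simp
  then show ?case by (simp add: mult_less_cancel_left)
qed

text \<open>Density arguments require only a finite word. Quantifying over all continuations
  \<open>s'\<close> leaves the other digits free, for instance to make a sequence periodic.\<close>

lemma digit_value_approx:
  assumes "0 \<le> x" "x \<le> 1"
  shows "\<exists>s. digits N s \<and> (\<forall>s'. digits N s' \<and> (\<forall>i<m. s' i = s i) \<longrightarrow> \<bar>digit_value N s' - x\<bar> \<le> 1 / real N ^ m)"
  using assms
proof (induction m arbitrary: x)
  case 0
  have "\<bar>digit_value N s' - x\<bar> \<le> 1" if "digits N s'" for s'
    using digit_value_nonneg[OF that] digit_value_le_1[OF that] 0 by linarith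
  then show ?case
    using N by (intro exI[of _ "\<lambda>_. 0"]) (simp add: digits_def)
next
  case (Suc m)
  \<comment> \<open>The cap at \<open>N - 1\<close> serves the case \<open>x = 1\<close>: the floor
    is \<open>N\<close>, which is no digit, and with the digit \<open>N - 1\<close> the remainder is
    1 again.\<close>
  define j where "j = min (nat \<lfloor>real N * x\<rfloor>) (N - 1)"
  have j: "j < N" "real j \<le> real N * x" "real N * x \<le> real j + 1"
  proof -
    show "j < N" using N by (simp add: j_def)
    have f: "real (nat \<lfloor>real N * x\<rfloor>) = of_int \<lfloor>real N * x\<rfloor>" using Suc.prems by simp
    show "real j \<le> real N * x" using f unfolding j_def by linarith
    have "real N * x \<le> real N" using Suc.prems by (simp add: mult_left_le)
    then show "real N * x \<le> real j + 1" using f N unfolding j_def by (auto simp: min_def; linarith)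
  qed
  define y where "y = real N * x - real j"
  obtain s where s: "digits N s"
    "\<And>s'. digits N s' \<Longrightarrow> (\<forall>i<m. s' i = s i) \<Longrightarrow> \<bar>digit_value N s' - y\<bar> \<le> 1 / real N ^ m"
    using Suc.IH[of y] j unfolding y_def by auto
  define u where "u = case_nat j s"
  have "digits N u" using s(1) j(1) unfolding digits_def u_def by (auto split: nat.splits)
  moreover have "\<bar>digit_value N s' - x\<bar> \<le> 1 / real N ^ Suc m"
    if s': "digits N s'" "\<forall>i<Suc m. s' i = u i" for s'
  proof -
    have "\<bar>digit_value N (\<lambda>i. s' (Suc i)) - y\<bar> \<le> 1 / real N ^ m"
      using s' by (intro s(2) digits_tail) (auto simp: u_def)
    moreover have "digit_value N (\<lambda>i. s' (Suc i)) - y = real N * (digit_value N s' - x)"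
      using s'(2) by (simp add: algebra_simps digit_value_rec'[OF s'(1)] y_def u_def)
    ultimately show ?thesis by (intro abs_le_inverse_power_Suc) simp
  qed
  ultimately show ?case by blast
qed

end

subsection \<open>Charts and coordinate rectangles\<close>

lemma Ck_on_const: "Ck_on k U (\<lambda>x. c)"
  by (induction k arbitrary: c) (auto simp: frechet_derivative_const)

lemma Ck_on_affine:
  assumes "bounded_linear A"
  shows "Ck_on k U (\<lambda>x. A x + c)"
proof (cases k)
  case 0
  then show ?thesis
    using assms by (auto intro!: continuous_intros bounded_linear.continuous_on[OF assms])
next
  case (Suc j)
  have d: "((\<lambda>x. A x + c) has_derivative A) (at x)" for x
    using has_derivative_add[OF bounded_linear_imp_has_derivative[OF assms] has_derivative_const] by simp
  then have "frechet_derivative (\<lambda>x. A x + c) (at x) = A" for x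
    by (rule frechet_derivative_at[symmetric])
  then show ?thesis
    using d by (auto simp: Suc Ck_on_const differentiable_def)
qed

text \<open>Serves both for the charts of boxes and for the affine branches of the Bakers map,
  extended to the ambient space.\<close>

definition diag_map :: "('a \<Rightarrow> real) \<Rightarrow> ('a \<Rightarrow> real) \<Rightarrow> 'a::euclidean_space \<Rightarrow> 'a" where
  "diag_map s c v = (\<Sum>b\<in>Basis. (s b * (v \<bullet> b) + c b) *\<^sub>R b)"

lemma inner_diag_map: "b \<in> Basis \<Longrightarrow> diag_map s c v \<bullet> b = s b * (v \<bullet> b) + c b"
  by (simp add: diag_map_def inner_sum_left_Basis)

lemma Ck_on_diag_map: "Ck_on k U (diag_map s c)"
proof -
  have "linear (\<lambda>v. \<Sum>b\<in>Basis. (s b * (v \<bullet> b)) *\<^sub>R b)"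
    by (rule linearI) (simp_all add: inner_add_left algebra_simps sum.distrib scaleR_sum_right)
  then have "Ck_on k U (\<lambda>v. (\<Sum>b\<in>Basis. (s b * (v \<bullet> b)) *\<^sub>R b) + (\<Sum>b\<in>Basis. c b *\<^sub>R b))"
    by (intro Ck_on_affine) (simp add: linear_conv_bounded_linear)
  then show ?thesis
    by (simp add: diag_map_def[abs_def] scaleR_left_distrib sum.distrib)
qed

lemma diffeo_between_diag_map:
  assumes "open U" and s: "\<And>b. b \<in> Basis \<Longrightarrow> s b \<noteq> 0"
  shows "diffeo_between U (diag_map s c ` U) (diag_map s c)"
proof -
  define g where "g = diag_map (\<lambda>b. 1 / s b) (\<lambda>b. - c b / s b)"
  have cont: "continuous_on X (diag_map s c)" "continuous_on X g" for X
    using Ck_on_diag_map[of 0] by (auto simp: g_def)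
  have gf: "g (diag_map s c v) = v" and fg: "diag_map s c (g v) = v" for v
    by (rule euclidean_eqI; simp add: g_def inner_diag_map s field_simps)+
  have "diag_map s c ` U = g -` U"
    by (auto simp: gf) (metis fg imageI)
  then have "open (diag_map s c ` U)"
    using cont(2) assms(1) by (simp add: open_vimage)
  moreover have "homeomorphism U (diag_map s c ` U) (diag_map s c) g"
    by (rule homeomorphismI) (auto simp: cont gf fg)
  moreover have "Ck_on k X g" for k X
    unfolding g_def by (rule Ck_on_diag_map)
  ultimately show ?thesis
    unfolding diffeo_between_def using assms(1) Ck_on_diag_map by blast
qed

text \<open>Near a given point each nondegenerate coordinate meets at most one of its two faces, so
  one half-space per coordinate describes the box. Degenerate coordinates are constant on the box
  and lower its dimension.\<close>

lemma submanifold_cbox: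
  fixes l u :: "'a::euclidean_space"
  assumes le: "\<And>b. b \<in> Basis \<Longrightarrow> l \<bullet> b \<le> u \<bullet> b"
  shows "submanifold (card {b\<in>Basis. l \<bullet> b < u \<bullet> b}) (cbox l u)"
  unfolding submanifold_def
proof
  fix x assume x: "x \<in> cbox l u"
  define B where "B = {b\<in>Basis. l \<bullet> b < u \<bullet> b}"
  \<comment> \<open>At an upper face the coordinate is reflected to \<open>u - v\<close>, otherwise
    translated to \<open>v - l\<close>; either way the face becomes the hyperplane 0.\<close>
  define s where "s b = (if b \<in> B \<and> x \<bullet> b = u \<bullet> b then - 1 else 1 :: real)" for b
  define c where "c b = (if b \<in> B \<and> x \<bullet> b = u \<bullet> b then u \<bullet> b else - (l \<bullet> b))" for b
  \<comment> \<open>Removes the opposite face in each direction, so that the half-space is the only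
    remaining constraint.\<close>
  define U where "U = (\<Inter>b\<in>B. if x \<bullet> b = u \<bullet> b then {v. l \<bullet> b < v \<bullet> b} else {v. v \<bullet> b < u \<bullet> b})"
  have B: "B \<subseteq> Basis" "finite B" by (auto simp: B_def)
  have "open U"
    unfolding U_def using B(2)
    by (intro open_INT) (auto intro!: open_Collect_less continuous_intros)
  moreover have "s b \<noteq> 0" for b by (simp add: s_def)
  ultimately have "diffeo_between U (diag_map s c ` U) (diag_map s c)"
    by (intro diffeo_between_diag_map)
  moreover have "x \<in> U"
    using x B(1) unfolding U_def B_def mem_box by (auto simp: less_le)
  moreover have "diag_map s c ` (cbox l u \<inter> U) = diag_map s c ` U \<inter>
      {v. (\<forall>b\<in>Basis - B. v \<bullet> b = 0) \<and> (\<forall>b\<in>B. 0 \<le> v \<bullet> b)}"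
  proof -
    have "v \<in> cbox l u \<longleftrightarrow> (\<forall>b\<in>Basis - B. diag_map s c v \<bullet> b = 0) \<and> (\<forall>b\<in>B. 0 \<le> diag_map s c v \<bullet> b)"
      if "v \<in> U" for v
    proof -
      have "l \<bullet> b \<le> v \<bullet> b \<and> v \<bullet> b \<le> u \<bullet> b \<longleftrightarrow> diag_map s c v \<bullet> b = 0" if "b \<in> Basis - B" for b
        using that le[of b] by (auto simp: inner_diag_map s_def c_def B_def)
      moreover have "l \<bullet> b \<le> v \<bullet> b \<and> v \<bullet> b \<le> u \<bullet> b \<longleftrightarrow> 0 \<le> diag_map s c v \<bullet> b" if b: "b \<in> B" for b
      proof -
        have "if x \<bullet> b = u \<bullet> b then l \<bullet> b < v \<bullet> b else v \<bullet> b < u \<bullet> b"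
          using \<open>v \<in> U\<close> b unfolding U_def by (auto split: if_splits)
        then show ?thesis
          using b B(1) by (auto simp: inner_diag_map s_def c_def split: if_splits)
      qed
      ultimately show ?thesis unfolding mem_box using B(1) by blast
    qed
    then show ?thesis by blast
  qed
  ultimately show "\<exists>U V \<phi> B' C. x \<in> U \<and> diffeo_between U V \<phi> \<and> C \<subseteq> B' \<and> B' \<subseteq> Basis \<and>
      card B' = card {b\<in>Basis. l \<bullet> b < u \<bullet> b} \<and>
      \<phi> ` (cbox l u \<inter> U) = V \<inter> {v. (\<forall>b\<in>Basis - B'. v \<bullet> b = 0) \<and> (\<forall>b\<in>C. 0 \<le> v \<bullet> b)}"
    using B(1) unfolding B_def[symmetric] by blast
qed

lemma finite_length_linepath: "finite_length (linepath a b)"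
  unfolding finite_length_def
proof (intro exI allI impI, elim conjE)
  fix n :: nat and r :: "nat \<Rightarrow> real"
  assume r: "\<forall>i\<le>n. r i \<in> {0..1}" "\<forall>i<n. r i \<le> r (Suc i)"
  have "dist (linepath a b x) (linepath a b y) = \<bar>y - x\<bar> * dist a b" for x y
  proof -
    have "linepath a b y - linepath a b x = (y - x) *\<^sub>R (b - a)"
      by (simp add: linepath_def algebra_simps)
    then show ?thesis by (metis dist_commute dist_norm norm_scaleR)
  qed
  then have "(\<Sum>i<n. dist (linepath a b (r i)) (linepath a b (r (Suc i)))) = (\<Sum>i<n. (r (Suc i) - r i) * dist a b)"
    using r(2) by (intro sum.cong) auto
  also have "\<dots> = (r n - r 0) * dist a b"
    by (simp add: sum_lessThan_telescope flip: sum_distrib_right)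
  also have "\<dots> \<le> 1 * dist a b"
    using r(1)[rule_format, of n] r(1)[rule_format, of 0] by (intro mult_right_mono) auto
  finally show "(\<Sum>i<n. dist (linepath a b (r i)) (linepath a b (r (Suc i)))) \<le> 1 * dist a b" .
qed

text \<open>The geometry takes place in a plane spanned by two basis vectors of an arbitrary
  Euclidean space; dimension 5 enters in the final theorem.\<close>

locale coordinate_plane =
  fixes e1 e2 :: "'a::euclidean_space"
  assumes e1: "e1 \<in> Basis" and e2: "e2 \<in> Basis" and e1_neq_e2: "e1 \<noteq> e2"
begin

definition pt :: "real \<Rightarrow> real \<Rightarrow> 'a" where
  "pt x y = x *\<^sub>R e1 + y *\<^sub>R e2"

lemma inner_pt_Basis: "b \<in> Basis \<Longrightarrow> pt x y \<bullet> b = (if b = e1 then x else if b = e2 then y else 0)"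
  using e1 e2 e1_neq_e2 by (auto simp: pt_def inner_add_left inner_Basis)

lemma inner_pt [simp]: "pt x y \<bullet> e1 = x" "pt x y \<bullet> e2 = y"
  using e1 e2 e1_neq_e2 by (auto simp: inner_pt_Basis)

lemma pt_eq_iff [simp]: "pt x y = pt x' y' \<longleftrightarrow> x = x' \<and> y = y'"
  by (metis inner_pt)

lemma pt_0: "pt 0 0 = 0"
  by (simp add: pt_def)

lemma pt_eq_0_iff [simp]: "pt x y = 0 \<longleftrightarrow> x = 0 \<and> y = 0"
  using pt_eq_iff[of x y 0 0] by (simp add: pt_0)

lemma pt_add: "pt x y + pt x' y' = pt (x + x') (y + y')"
  by (simp add: pt_def algebra_simps)

lemma pt_scale: "r *\<^sub>R pt x y = pt (r * x) (r * y)"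
  by (simp add: pt_def algebra_simps)

lemma eq_ptI:
  assumes "\<And>b. b \<in> Basis \<Longrightarrow> b \<noteq> e1 \<Longrightarrow> b \<noteq> e2 \<Longrightarrow> v \<bullet> b = 0"
  shows "v = pt (v \<bullet> e1) (v \<bullet> e2)"
  by (rule euclidean_eqI) (auto simp: inner_pt_Basis assms)

lemma mem_cbox_pt:
  "v \<in> cbox (pt x y) (pt x' y') \<longleftrightarrow> (\<exists>u w. v = pt u w \<and> u \<in> {x..x'} \<and> w \<in> {y..y'})"
proof
  assume v: "v \<in> cbox (pt x y) (pt x' y')"
  have "v \<bullet> b = 0" if "b \<in> Basis" "b \<noteq> e1" "b \<noteq> e2" for b
    using v that unfolding mem_box by (auto simp: inner_pt_Basis intro: antisym)
  then have "v = pt (v \<bullet> e1) (v \<bullet> e2)" by (rule eq_ptI)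
  moreover have "v \<bullet> e1 \<in> {x..x'}" "v \<bullet> e2 \<in> {y..y'}"
    using v e1 e2 unfolding mem_box by auto
  ultimately show "\<exists>u w. v = pt u w \<and> u \<in> {x..x'} \<and> w \<in> {y..y'}" by blast
qed (use e1_neq_e2 in \<open>auto simp: mem_box inner_pt_Basis\<close>)

lemma pt_mem_cbox [simp]: "pt u w \<in> cbox (pt x y) (pt x' y') \<longleftrightarrow> u \<in> {x..x'} \<and> w \<in> {y..y'}"
  by (auto simp: mem_cbox_pt)

lemma dist_pt_le: "dist (pt x y) (pt x' y') \<le> \<bar>x - x'\<bar> + \<bar>y - y'\<bar>"
proof -
  have "pt x y - pt x' y' = (x - x') *\<^sub>R e1 + (y - y') *\<^sub>R e2"
    by (simp add: pt_def algebra_simps)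
  then show ?thesis
    using norm_triangle_ineq[of "(x - x') *\<^sub>R e1" "(y - y') *\<^sub>R e2"] e1 e2 by (simp add: dist_norm)
qed

lemma abs_inner_diff_le:
  "\<bar>v \<bullet> e1 - w \<bullet> e1\<bar> \<le> dist v w" "\<bar>v \<bullet> e2 - w \<bullet> e2\<bar> \<le> dist v w"
  using Basis_le_norm[OF e1, of "v - w"] Basis_le_norm[OF e2, of "v - w"]
  by (simp_all add: dist_norm inner_diff_left)

lemma tendsto_pt:
  "(f \<longlongrightarrow> x) F \<Longrightarrow> (g \<longlongrightarrow> y) F \<Longrightarrow> ((\<lambda>i. pt (f i) (g i)) \<longlongrightarrow> pt x y) F"
  unfolding pt_def by (intro tendsto_intros)

lemma linear_pt: "linear (\<lambda>z. pt (fst z) (snd z))"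
  by (rule linearI) (auto simp: pt_def algebra_simps)

lemma inj_pt: "inj (\<lambda>z. pt (fst z) (snd z))"
  by (rule injI) (auto simp: prod_eq_iff)

lemma norm_pt: "norm (pt x y) = norm (x, y)"
proof -
  have "pt x y \<bullet> pt x y = x\<^sup>2 + y\<^sup>2"
    using e1 e2 e1_neq_e2
    by (simp add: pt_def inner_add_left inner_add_right inner_Basis power2_eq_square)
  then show ?thesis by (simp add: norm_eq_sqrt_inner power2_eq_square)
qed

lemma submanifold_pt_cbox:
  assumes "x \<le> x'" "y \<le> y'"
  shows "submanifold ((if x < x' then 1 else 0) + (if y < y' then 1 else 0)) (cbox (pt x y) (pt x' y'))"
proof -
  have "{b\<in>Basis. pt x y \<bullet> b < pt x' y' \<bullet> b} = (if x < x' then {e1} else {}) \<union> (if y < y' then {e2} else {})"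
    using e1 e2 e1_neq_e2 by (auto simp: inner_pt_Basis split: if_splits)
  then have "card {b\<in>Basis. pt x y \<bullet> b < pt x' y' \<bullet> b} = (if x < x' then 1 else 0) + (if y < y' then 1 else 0)"
    using e1_neq_e2 by simp
  moreover have "pt x y \<bullet> b \<le> pt x' y' \<bullet> b" if "b \<in> Basis" for b
    using that assms by (simp add: inner_pt_Basis)
  ultimately show ?thesis using submanifold_cbox[of "pt x y" "pt x' y'"] by simp
qed

definition open_rect :: "real \<Rightarrow> real \<Rightarrow> real \<Rightarrow> real \<Rightarrow> 'a set" where
  "open_rect x y x' y' = {pt u w | u w. x < u \<and> u < x' \<and> y < w \<and> w < y'}"

lemma pt_mem_open_rect [simp]:
  "pt u w \<in> open_rect x y x' y' \<longleftrightarrow> x < u \<and> u < x' \<and> y < w \<and> w < y'"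
  by (auto simp: open_rect_def)

lemma open_rect_subset_cbox: "open_rect x y x' y' \<subseteq> cbox (pt x y) (pt x' y')"
  by (auto simp: open_rect_def)

text \<open>The boundary of a rectangle and the circle are relative frontiers of two bounded convex
  sets of equal dimension. The linear isometry behind \<open>pt\<close> carries this from the model
  plane into the ambient space.\<close>

lemma topological_sphere_rect_boundary:
  assumes "a < b" "c < d"
  shows "topological_sphere 1 (cbox (pt a c) (pt b d) - open_rect a c b d)"
proof -
  let ?P = "\<lambda>z::real \<times> real. pt (fst z) (snd z)"
  let ?Q = "cbox (a, c) (b, d)"
  have "cbox (pt a c) (pt b d) - open_rect a c b d = ?P ` (?Q - box (a, c) (b, d))"
  proof -
    have "cbox (pt a c) (pt b d) = ?P ` ?Q"
      by (force simp: mem_cbox_pt cbox_Pair_eq image_iff)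
    moreover have "open_rect a c b d = ?P ` box (a, c) (b, d)"
      by (force simp: open_rect_def box_prod image_iff)
    ultimately show ?thesis by (simp add: image_set_diff[OF inj_pt])
  qed
  also have "\<dots> homeomorphic (?Q - box (a, c) (b, d))"
    using linear_homeomorphic_image[OF linear_pt inj_pt] homeomorphic_sym by blast
  also have "?Q - box (a, c) (b, d) = rel_frontier ?Q"
  proof -
    have "((a + b) / 2, (c + d) / 2) \<in> interior ?Q"
      using assms by (simp add: box_prod)
    then have "rel_frontier ?Q = frontier ?Q"
      by (intro rel_frontier_nonempty_interior) blast
    then show ?thesis by (simp add: frontier_cbox)
  qed
  also have "\<dots> homeomorphic rel_frontier (cball (0 :: real \<times> real) 1)"
  proof (rule homeomorphic_rel_frontiers_convex_bounded_sets)
    have "interior ?Q \<noteq> {}"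
    proof -
      have "((a + b) / 2, (c + d) / 2) \<in> interior ?Q"
        using assms by (simp add: box_prod)
      then show ?thesis by blast
    qed
    then show "aff_dim ?Q = aff_dim (cball (0 :: real \<times> real) 1)"
      by (simp add: aff_dim_nonempty_interior aff_dim_cball)
  qed (auto simp: bounded_cbox)
  also have "rel_frontier (cball (0 :: real \<times> real) 1) = sphere 0 1"
    by (simp add: rel_frontier_cball)
  also have "\<dots> homeomorphic ?P ` sphere 0 1"
    by (rule linear_homeomorphic_image[OF linear_pt inj_pt])
  also have "?P ` sphere 0 1 = sphere 0 1 \<inter> span {e1, e2}"
  proof -
    have "span {e1, e2} = {v. \<forall>b\<in>Basis. b \<notin> {e1, e2} \<longrightarrow> v \<bullet> b = 0}"
      using e1 e2 by (intro span_substd_basis) auto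
    moreover have "v \<in> ?P ` sphere 0 1"
      if "\<forall>b\<in>Basis. b \<notin> {e1, e2} \<longrightarrow> v \<bullet> b = 0" "norm v = 1" for v
    proof -
      have v: "v = pt (v \<bullet> e1) (v \<bullet> e2)" using eq_ptI[of v] that(1) by blast
      then have "norm (v \<bullet> e1, v \<bullet> e2) = 1" using that(2) norm_pt by metis
      then show ?thesis using v by (intro image_eqI[of _ _ "(v \<bullet> e1, v \<bullet> e2)"]) simp_all
    qed
    moreover have "norm (?P z) = norm z" for z by (simp add: norm_pt)
    ultimately show ?thesis
      by (auto simp: inner_pt_Basis)
  qed
  finally show ?thesis
    unfolding topological_sphere_def using e1 e2 e1_neq_e2
    by (intro exI[of _ "{e1, e2}"]) auto
qed

lemma closed_segment_pt:
  "closed_segment (pt x c) (pt x d) = pt x ` closed_segment c d"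
  "closed_segment (pt c y) (pt d y) = (\<lambda>x. pt x y) ` closed_segment c d"
proof -
  have *: "closed_segment (f c) (f d) = f ` closed_segment c d"
    if "\<And>u. (1 - u) *\<^sub>R f c + u *\<^sub>R f d = f ((1 - u) * c + u * d)" for f :: "real \<Rightarrow> 'a"
    unfolding closed_segment_def by (auto simp: that)
  show "closed_segment (pt x c) (pt x d) = pt x ` closed_segment c d"
    by (rule *) (simp add: pt_scale pt_add algebra_simps)
  show "closed_segment (pt c y) (pt d y) = (\<lambda>x. pt x y) ` closed_segment c d"
    by (rule *) (simp add: pt_scale pt_add algebra_simps)
qed

end

subsection \<open>The N-fold Bakers map\<close>

context coordinate_plane
begin

lemma pt_in_closureI:
  assumes "\<And>\<epsilon>. 0 < \<epsilon> \<Longrightarrow> \<epsilon> \<le> 1 \<Longrightarrow> pt (u + \<epsilon> * p) (w + \<epsilon> * q) \<in> A"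
  shows "pt u w \<in> closure A"
proof -
  have "(\<lambda>k. pt (u + 1 / real (Suc k) * p) (w + 1 / real (Suc k) * q)) \<longlonglongrightarrow> pt (u + 0 * p) (w + 0 * q)"
    using LIMSEQ_inverse_real_of_nat by (intro tendsto_pt tendsto_intros) (simp_all add: inverse_eq_divide)
  moreover have "pt (u + 1 / real (Suc k) * p) (w + 1 / real (Suc k) * q) \<in> A" for k
    by (rule assms) (auto simp: divide_le_eq)
  ultimately show ?thesis
    unfolding closure_sequential
    by (intro exI[of _ "\<lambda>k. pt (u + 1 / real (Suc k) * p) (w + 1 / real (Suc k) * q)"]) simp
qed

lemma convex_strict:
  fixes \<epsilon> x u x' m :: real
  assumes "0 < \<epsilon>" "\<epsilon> \<le> 1" "x \<le> u" "u \<le> x'" "x < m" "m < x'"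
  shows "x < u + \<epsilon> * (m - u)" "u + \<epsilon> * (m - u) < x'"
proof -
  have "0 \<le> (1 - \<epsilon>) * (u - x)" "0 < \<epsilon> * (m - x)" "0 \<le> (1 - \<epsilon>) * (x' - u)" "0 < \<epsilon> * (x' - m)"
    using assms by auto
  then show "x < u + \<epsilon> * (m - u)" "u + \<epsilon> * (m - u) < x'" by (auto simp: algebra_simps)
qed

lemma closure_open_rect:
  assumes "x < x'" "y < y'"
  shows "closure (open_rect x y x' y') = cbox (pt x y) (pt x' y')"
proof
  show "closure (open_rect x y x' y') \<subseteq> cbox (pt x y) (pt x' y')"
    by (intro closure_minimal open_rect_subset_cbox closed_cbox)
  show "cbox (pt x y) (pt x' y') \<subseteq> closure (open_rect x y x' y')"
  proof
    fix v assume "v \<in> cbox (pt x y) (pt x' y')"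
    then obtain u w where v: "v = pt u w" "u \<in> {x..x'}" "w \<in> {y..y'}"
      by (auto simp: mem_cbox_pt)
    show "v \<in> closure (open_rect x y x' y')"
      unfolding v(1)
      by (rule pt_in_closureI[where p = "(x + x') / 2 - u" and q = "(y + y') / 2 - w"])
        (use v assms in \<open>auto intro!: convex_strict\<close>)
  qed
qed

definition unit_square :: "'a set" where
  "unit_square = cbox (pt 0 0) (pt 1 1)"

lemma pt_mem_unit_square [simp]: "pt x y \<in> unit_square \<longleftrightarrow> 0 \<le> x \<and> x \<le> 1 \<and> 0 \<le> y \<and> y \<le> 1"
  by (auto simp: unit_square_def)

lemma unit_squareE:
  assumes "v \<in> unit_square"
  obtains x y where "v = pt x y" "0 \<le> x" "x \<le> 1" "0 \<le> y" "y \<le> 1"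
  using assms by (auto simp: unit_square_def mem_cbox_pt)

lemma openin_open_rect:
  assumes "0 \<le> x" "x' \<le> 1" "0 \<le> y" "y' \<le> 1"
  shows "openin (top_of_set unit_square) (open_rect x y x' y')"
proof -
  let ?W = "{v. x < v \<bullet> e1} \<inter> {v. v \<bullet> e1 < x'} \<inter> {v. y < v \<bullet> e2} \<inter> {v. v \<bullet> e2 < y'}"
  have "open ?W" by (intro open_Int open_Collect_less continuous_intros)
  moreover have "open_rect x y x' y' = unit_square \<inter> ?W"
    using assms by (auto simp: open_rect_def elim!: unit_squareE)
  ultimately show ?thesis unfolding openin_open by blast
qed

section \<open>Holes whose complement is a rectangle inside the square\<close>

context
  fixes a b c d :: real
  assumes abcd: "0 < a" "a < b" "b < 1" "0 < c" "c < d" "d < 1"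
begin

lemma closure_rect_complement:
  "closure (unit_square - cbox (pt a c) (pt b d)) = unit_square - open_rect a c b d"
    (is "closure ?H = _")
proof
  have "openin (top_of_set unit_square) (open_rect a c b d)"
    using abcd by (intro openin_open_rect) auto
  then have "closedin (top_of_set unit_square) (unit_square - open_rect a c b d)"
    by (simp add: closedin_diff)
  then have "closed (unit_square - open_rect a c b d)"
    by (rule closedin_closed_trans) (simp add: unit_square_def closed_cbox)
  then show "closure ?H \<subseteq> unit_square - open_rect a c b d"
    using open_rect_subset_cbox[of a c b d] by (intro closure_minimal) auto
  show "unit_square - open_rect a c b d \<subseteq> closure ?H"
  proof
    fix v assume v: "v \<in> unit_square - open_rect a c b d"
    show "v \<in> closure ?H"
    proof (cases "v \<in> cbox (pt a c) (pt b d)")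
      case False
      then show ?thesis using v by (intro subsetD[OF closure_subset]) simp
    next
      case True
      then obtain u w where uw: "v = pt u w" "a \<le> u" "u \<le> b" "c \<le> w" "w \<le> d"
        by (auto simp: mem_cbox_pt)
      then consider "u = a" | "u = b" | "w = c" | "w = d"
        using v by fastforce
      then show ?thesis
      proof cases
        case 1
        \<comment> \<open>A boundary point is pushed outwards, towards the parallel side of the
          square. Scaling by the distance to that side keeps it in the square; the other cases are
          alike.\<close>
        have "pt (u + \<epsilon> * (- a)) (w + \<epsilon> * 0) \<in> ?H" if "0 < \<epsilon>" "\<epsilon> \<le> 1" for \<epsilon>
        proof -
          have "0 < \<epsilon> * a" "\<epsilon> * a \<le> a"
            using that abcd by (auto intro: mult_left_le_one_le)
          then show ?thesis using 1 uw abcd by (auto simp: algebra_simps)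
        qed
        then show ?thesis unfolding uw(1) by (rule pt_in_closureI)
      next
        case 2
        have "pt (u + \<epsilon> * (1 - b)) (w + \<epsilon> * 0) \<in> ?H" if "0 < \<epsilon>" "\<epsilon> \<le> 1" for \<epsilon>
        proof -
          have "0 < \<epsilon> * (1 - b)" "\<epsilon> * (1 - b) \<le> (1 - b)"
            using that abcd by (auto intro: mult_left_le_one_le)
          then show ?thesis using 2 uw abcd by (auto simp: algebra_simps)
        qed
        then show ?thesis unfolding uw(1) by (rule pt_in_closureI)
      next
        case 3
        have "pt (u + \<epsilon> * 0) (w + \<epsilon> * (- c)) \<in> ?H" if "0 < \<epsilon>" "\<epsilon> \<le> 1" for \<epsilon>
        proof -
          have "0 < \<epsilon> * c" "\<epsilon> * c \<le> c"
            using that abcd by (auto intro: mult_left_le_one_le)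
          then show ?thesis using 3 uw abcd by (auto simp: algebra_simps)
        qed
        then show ?thesis unfolding uw(1) by (rule pt_in_closureI)
      next
        case 4
        have "pt (u + \<epsilon> * 0) (w + \<epsilon> * (1 - d)) \<in> ?H" if "0 < \<epsilon>" "\<epsilon> \<le> 1" for \<epsilon>
        proof -
          have "0 < \<epsilon> * (1 - d)" "\<epsilon> * (1 - d) \<le> (1 - d)"
            using that abcd by (auto intro: mult_left_le_one_le)
          then show ?thesis using 4 uw abcd by (auto simp: algebra_simps)
        qed
        then show ?thesis unfolding uw(1) by (rule pt_in_closureI)
      qed
    qed
  qed
qed

lemma rect_complement_boundary:
  "closure (unit_square - cbox (pt a c) (pt b d)) - (unit_square - cbox (pt a c) (pt b d)) =
    cbox (pt a c) (pt b d) - open_rect a c b d"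
proof -
  have "cbox (pt a c) (pt b d) \<subseteq> unit_square"
    using abcd by (auto simp: mem_cbox_pt)
  then show ?thesis unfolding closure_rect_complement by blast
qed

text \<open>The hole is regular open because every point of the closed rectangle is a limit of
  points of the open one, which the closure of the hole misses.\<close>

lemma hole_rect_complement: "hole 2 unit_square (unit_square - cbox (pt a c) (pt b d))"
    (is "hole 2 _ ?H")
proof -
  have op: "openin (top_of_set unit_square) ?H"
    unfolding Diff_eq by (intro openin_open_Int open_Compl closed_cbox)
  have "(top_of_set unit_square) interior_of (closure ?H) = ?H"
  proof
    show "?H \<subseteq> (top_of_set unit_square) interior_of (closure ?H)"
      by (intro interior_of_maximal closure_subset op)
    show "(top_of_set unit_square) interior_of (closure ?H) \<subseteq> ?H"
    proof
      fix v assume "v \<in> (top_of_set unit_square) interior_of (closure ?H)"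
      then obtain W where W: "open W" "v \<in> W" "v \<in> unit_square" "unit_square \<inter> W \<subseteq> closure ?H"
        unfolding interior_of_def openin_open by auto
      show "v \<in> ?H"
      proof (rule ccontr)
        assume "v \<notin> ?H"
        then have "v \<in> closure (open_rect a c b d)"
          using W(3) abcd by (simp add: closure_open_rect)
        then obtain z where "z \<in> W" "z \<in> open_rect a c b d"
          using W(1,2) by (meson closure_iff_nhds_not_empty disjoint_iff order_refl)
        moreover have "open_rect a c b d \<subseteq> unit_square"
          using abcd by (auto simp: open_rect_def)
        ultimately show False
          using W(4) unfolding closure_rect_complement by blast
      qed
    qed
  qed
  moreover have "topological_sphere (2 - 1) (cbox (pt a c) (pt b d) - open_rect a c b d)"
    using topological_sphere_rect_boundary abcd by simp
  ultimately show ?thesis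
    unfolding hole_def rect_complement_boundary
    by (intro conjI op exI[of _ "{cbox (pt a c) (pt b d) - open_rect a c b d}"]) auto
qed

lemma rect_boundary_eq_segments:
  "cbox (pt a c) (pt b d) - open_rect a c b d =
    (\<Union>\<gamma>\<in>{linepath (pt a c) (pt a d), linepath (pt b c) (pt b d),
           linepath (pt a c) (pt b c), linepath (pt a d) (pt b d)}. path_image \<gamma>)"
    (is "?L = ?R")
proof -
  have R: "?R = pt a ` {c..d} \<union> pt b ` {c..d} \<union> (\<lambda>x. pt x c) ` {a..b} \<union> (\<lambda>x. pt x d) ` {a..b}"
    using abcd by (simp add: closed_segment_pt closed_segment_eq_real_ivl Un_assoc)
  show ?thesis
  proof
    show "?L \<subseteq> ?R"
    proof
      fix v assume v: "v \<in> ?L"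
      then obtain u w where uw: "v = pt u w" "u \<in> {a..b}" "w \<in> {c..d}"
        by (auto simp: mem_cbox_pt)
      then have "u = a \<or> u = b \<or> w = c \<or> w = d"
        using v by fastforce
      then show "v \<in> ?R" unfolding R using uw by blast
    qed
    show "?R \<subseteq> ?L" unfolding R using abcd by auto
  qed
qed

end

end

section \<open>The map, its strips and its singularity set\<close>

locale baker = coordinate_plane e1 e2 for e1 e2 :: "'a::euclidean_space" +
  fixes N :: nat
  assumes N: "4 \<le> N"
begin

text \<open>The lines include both vertical sides of the square, so a point of the square off
  \<open>sing\<close> lies in exactly one open strip.\<close>

definition sing :: "'a set" where
  "sing = {v \<in> unit_square. v \<bullet> e2 = 0 \<or> v \<bullet> e2 = 1 \<or> real N * (v \<bullet> e1) \<in> \<int>}"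

definition baker_map :: "'a \<Rightarrow> 'a" where
  "baker_map v = (if v \<in> sing then 0 else
     (let i = \<lfloor>real N * (v \<bullet> e1)\<rfloor> in pt (real N * (v \<bullet> e1) - of_int i) ((v \<bullet> e2 + of_int i) / real N)))"

definition strip :: "nat \<Rightarrow> 'a set" where
  "strip i = cbox (pt (real i / real N) 0) (pt (real (Suc i) / real N) 1)"

definition open_strip :: "nat \<Rightarrow> 'a set" where
  "open_strip i = open_rect (real i / real N) 0 (real (Suc i) / real N) 1"

lemma pt_mem_open_strip [simp]:
  "pt x y \<in> open_strip i \<longleftrightarrow> real i < real N * x \<and> real N * x < real i + 1 \<and> 0 < y \<and> y < 1"
  using N by (auto simp: open_strip_def field_simps)

lemma pt_mem_strip [simp]:
  "pt x y \<in> strip i \<longleftrightarrow> real i \<le> real N * x \<and> real N * x \<le> real i + 1 \<and> 0 \<le> y \<and> y \<le> 1"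
  using N by (auto simp: strip_def field_simps)

lemma open_stripE:
  assumes "v \<in> open_strip i"
  obtains x y where "v = pt x y" "real i < real N * x" "real N * x < real i + 1" "0 < y" "y < 1"
proof -
  obtain x y where "v = pt x y" using assms by (auto simp: open_strip_def open_rect_def)
  then show thesis using assms by (intro that[of x y]) auto
qed

lemma stripE:
  assumes "v \<in> strip i"
  obtains x y where "v = pt x y" "real i \<le> real N * x" "real N * x \<le> real i + 1" "0 \<le> y" "y \<le> 1"
proof -
  obtain x y where "v = pt x y" using assms by (auto simp: strip_def mem_cbox_pt)
  then show thesis using assms by (intro that[of x y]) auto
qed

lemma pt_mem_sing:
  "pt x y \<in> sing \<longleftrightarrow> pt x y \<in> unit_square \<and> (y = 0 \<or> y = 1 \<or> real N * x \<in> \<int>)"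
  by (simp add: sing_def)

lemma zero_in_sing: "0 \<in> sing"
  unfolding pt_0[symmetric] by (simp add: pt_mem_sing del: pt_eq_0_iff)

lemma baker_map_sing: "v \<in> sing \<Longrightarrow> baker_map v = 0"
  by (simp add: baker_map_def)

lemma not_int_between:
  assumes "real i < x" "x < real i + 1"
  shows "x \<notin> \<int>"
proof
  assume "x \<in> \<int>"
  then obtain k where "x = of_int k" by (auto elim: Ints_cases)
  then have "int i < k" "k < int i + 1" using assms by linarith+
  then show False by simp
qed

lemma strip_subset_square: "i < N \<Longrightarrow> strip i \<subseteq> unit_square"
proof
  fix v assume i: "i < N" and "v \<in> strip i"
  then obtain x y where v: "v = pt x y" "real i \<le> real N * x" "real N * x \<le> real i + 1" "0 \<le> y" "y \<le> 1"
    by (auto elim: stripE)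
  have "0 \<le> real N * x" "real N * x \<le> real N * 1" using v i by linarith+
  then have "0 \<le> x" "x \<le> 1" using N by (auto simp: zero_le_mult_iff)
  then show "v \<in> unit_square" using v by simp
qed

lemma open_strip_subset_strip: "open_strip i \<subseteq> strip i"
  by (auto elim!: open_stripE)

lemma open_strip_disjoint_sing: "open_strip i \<inter> sing = {}"
  using not_int_between by (auto elim!: open_stripE simp: pt_mem_sing)

lemma strip_diff_sing: "i < N \<Longrightarrow> strip i - sing = open_strip i"
proof
  assume i: "i < N"
  show "strip i - sing \<subseteq> open_strip i"
  proof
    fix v assume v: "v \<in> strip i - sing"
    then obtain x y where xy: "v = pt x y" "real i \<le> real N * x" "real N * x \<le> real i + 1" "0 \<le> y" "y \<le> 1"
      by (auto elim: stripE)
    have "pt x y \<in> unit_square" "pt x y \<notin> sing"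
      using v strip_subset_square[OF i] unfolding xy(1) by blast+
    then have "real N * x \<notin> \<int>" "y \<noteq> 0" "y \<noteq> 1"
      by (auto simp: pt_mem_sing)
    moreover from this have "real N * x \<noteq> real i" "real N * x \<noteq> real i + 1" by auto
    ultimately show "v \<in> open_strip i" using xy by simp
  qed
qed (use open_strip_disjoint_sing open_strip_subset_strip in blast)

lemma square_eq_strips: "unit_square = (\<Union>i<N. strip i)"
proof
  show "unit_square \<subseteq> (\<Union>i<N. strip i)"
  proof
    fix v assume "v \<in> unit_square"
    then obtain x y where v: "v = pt x y" "0 \<le> x" "x \<le> 1" "0 \<le> y" "y \<le> 1"
      by (rule unit_squareE)
    define j where "j = min (nat \<lfloor>real N * x\<rfloor>) (N - 1)"
    have f: "real (nat \<lfloor>real N * x\<rfloor>) = of_int \<lfloor>real N * x\<rfloor>" using v by simp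
    have "j < N" using N by (simp add: j_def)
    moreover have "real j \<le> real N * x" using f unfolding j_def by linarith
    moreover have "real N * x \<le> real N" using v by (simp add: mult_left_le)
    then have "real N * x \<le> real j + 1" using f N unfolding j_def by (auto simp: min_def; linarith)
    ultimately show "v \<in> (\<Union>i<N. strip i)" using v by auto
  qed
qed (use strip_subset_square in blast)

lemma square_diff_sing: "unit_square - sing = (\<Union>i<N. open_strip i)"
  unfolding square_eq_strips using strip_diff_sing by blast

lemma baker_map_open_strip:
  assumes "pt x y \<in> open_strip i"
  shows "baker_map (pt x y) = pt (real N * x - real i) ((y + real i) / real N)"
proof -
  have "\<lfloor>real N * x\<rfloor> = int i" using assms by (simp add: floor_eq_iff)
  moreover have "pt x y \<notin> sing" using assms open_strip_disjoint_sing by blast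
  ultimately show ?thesis by (simp add: baker_map_def)
qed

lemma baker_map_image: "baker_map ` unit_square \<subseteq> unit_square"
proof
  fix u assume "u \<in> baker_map ` unit_square"
  then obtain v where v: "v \<in> unit_square" "u = baker_map v" by blast
  show "u \<in> unit_square"
  proof (cases "v \<in> sing")
    case True
    then show ?thesis using v pt_mem_unit_square[of 0 0] by (simp add: baker_map_sing pt_0)
  next
    case False
    then obtain i where i: "i < N" "v \<in> open_strip i" using v(1) square_diff_sing by blast
    obtain x y where xy: "v = pt x y" "real i < real N * x" "real N * x < real i + 1" "0 < y" "y < 1"
      using i(2) by (rule open_stripE)
    have "y + real i \<le> real N" using xy i(1) by linarith
    then show ?thesis
      using xy i N unfolding v(2) by (simp add: baker_map_open_strip)
  qed
qed

lemma local_diffeo_baker_map: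
  assumes "v \<in> unit_square - sing"
  shows "local_diffeo_at unit_square baker_map v"
proof -
  obtain i where i: "i < N" "v \<in> open_strip i" using assms square_diff_sing by blast
  \<comment> \<open>The branch over strip \<open>i\<close>, extended to the ambient space; the
    factor 1 in the transversal directions keeps the extension invertible.\<close>
  define s where "s b = (if b = e1 then real N else if b = e2 then 1 / real N else 1)" for b
  define c where "c b = (if b = e1 then - real i else if b = e2 then real i / real N else 0)" for b
  define U where "U = {v. real i < real N * (v \<bullet> e1)} \<inter> {v. real N * (v \<bullet> e1) < real i + 1} \<inter>
    {v. 0 < v \<bullet> e2} \<inter> {v. v \<bullet> e2 < 1}"
  have "open U" unfolding U_def by (intro open_Int open_Collect_less continuous_intros)
  moreover have "s b \<noteq> 0" for b using N by (simp add: s_def)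
  ultimately have "diffeo_between U (diag_map s c ` U) (diag_map s c)"
    by (intro diffeo_between_diag_map)
  moreover have "v \<in> U" using i(2) unfolding U_def by (auto elim!: open_stripE)
  moreover have U_square: "unit_square \<inter> U = open_strip i"
    using strip_subset_square[OF i(1)] open_strip_subset_strip[of i]
    unfolding U_def by (auto elim!: unit_squareE open_stripE)
  have dm: "diag_map s c (pt x y) = pt (real N * x - real i) ((y + real i) / real N)" for x y
    by (rule euclidean_eqI) (use e1_neq_e2 in \<open>auto simp: inner_diag_map inner_pt_Basis s_def c_def add_divide_distrib\<close>)
  have "\<forall>y\<in>unit_square \<inter> U. baker_map y = diag_map s c y"
    unfolding U_square by (auto simp: baker_map_open_strip dm elim!: open_stripE)
  moreover have "diag_map s c ` (unit_square \<inter> U) = unit_square \<inter> diag_map s c ` U"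
  proof
    show "diag_map s c ` (unit_square \<inter> U) \<subseteq> unit_square \<inter> diag_map s c ` U"
      using calculation(3) baker_map_image by auto
    show "unit_square \<inter> diag_map s c ` U \<subseteq> diag_map s c ` (unit_square \<inter> U)"
    proof
      fix z assume "z \<in> unit_square \<inter> diag_map s c ` U"
      then obtain u where u: "u \<in> U" "z = diag_map s c u" "diag_map s c u \<in> unit_square" by blast
      \<comment> \<open>\<open>U\<close> also contains points off the plane. The extension fixes
        transversal coordinates, so points with image in the square lie in the plane.\<close>
      have "u \<bullet> b = 0" if "b \<in> Basis" "b \<noteq> e1" "b \<noteq> e2" for b
      proof -
        have "diag_map s c u \<bullet> b = 0"
          using u(3) that by (auto simp: inner_pt_Basis elim!: unit_squareE)
        then show ?thesis using that by (simp add: inner_diag_map s_def c_def)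
      qed
      then have eq: "u = pt (u \<bullet> e1) (u \<bullet> e2)" by (rule eq_ptI)
      have "pt (u \<bullet> e1) (u \<bullet> e2) \<in> open_strip i" using u(1) by (simp add: U_def)
      then have "u \<in> unit_square" using eq U_square by auto
      then show "z \<in> diag_map s c ` (unit_square \<inter> U)" using u by blast
    qed
  qed
  ultimately show ?thesis unfolding local_diffeo_at_def by blast
qed

lemma piecewise_local_diffeo_baker: "piecewise_local_diffeo 2 unit_square baker_map sing"
proof -
  define \<T> where "\<T> = {cbox (pt 0 0) (pt 1 0), cbox (pt 0 1) (pt 1 1)} \<union>
    (\<lambda>i. cbox (pt (real i / real N) 0) (pt (real i / real N) 1)) ` {..N}"
  have sub: "submanifold 1 (cbox (pt 0 0) (pt 1 0))" "submanifold 1 (cbox (pt 0 1) (pt 1 1))"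
    "submanifold 1 (cbox (pt x 0) (pt x 1))" for x
    using submanifold_pt_cbox[of 0 1 0 0] submanifold_pt_cbox[of 0 1 1 1] submanifold_pt_cbox[of x x 0 1]
    by simp_all
  have "\<Union>\<T> = sing"
  proof
    show "\<Union>\<T> \<subseteq> sing"
      using N by (auto simp: \<T>_def mem_cbox_pt pt_mem_sing)
    show "sing \<subseteq> \<Union>\<T>"
    proof
      fix v assume v: "v \<in> sing"
      then obtain x y where xy: "v = pt x y" "0 \<le> x" "x \<le> 1" "0 \<le> y" "y \<le> 1"
        by (auto simp: sing_def elim: unit_squareE)
      consider "y = 0" | "y = 1" | "real N * x \<in> \<int>" using v by (auto simp: xy(1) pt_mem_sing)
      then show "v \<in> \<Union>\<T>"
      proof cases
        case 3
        then obtain k where k: "real N * x = of_int k" by (auto elim: Ints_cases)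
        have "0 \<le> real N * x" "real N * x \<le> real N" using xy by (auto simp: mult_left_le)
        then have "0 \<le> k" "k \<le> int N" using k by linarith+
        then have "real (nat k) = real N * x" "nat k \<le> N" using k by auto
        moreover from this have "x = real (nat k) / real N" using N by (simp add: field_simps)
        ultimately have "v \<in> cbox (pt (real (nat k) / real N) 0) (pt (real (nat k) / real N) 1)"
          using xy by simp
        then show ?thesis using \<open>nat k \<le> N\<close> unfolding \<T>_def by blast
      qed (use xy in \<open>auto simp: \<T>_def\<close>)
    qed
  qed
  moreover have "finite \<T>" by (simp add: \<T>_def)
  moreover have "T \<subseteq> sing \<and> compact T \<and> submanifold (2 - 1) T" if "T \<in> \<T>" for T
    using that sub calculation(1) by (auto simp: \<T>_def compact_cbox)
  ultimately show ?thesis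
    unfolding piecewise_local_diffeo_def
    using baker_map_image local_diffeo_baker_map unfolding sing_def by blast
qed

end

subsection \<open>Symbolic coding\<close>

context baker
begin

definition future :: "(int \<Rightarrow> nat) \<Rightarrow> int \<Rightarrow> real" where
  "future w k = digit_value N (\<lambda>i. w (k + int i))"

definition past :: "(int \<Rightarrow> nat) \<Rightarrow> int \<Rightarrow> real" where
  "past w k = digit_value N (\<lambda>i. w (k - 1 - int i))"

text \<open>In these coordinates the Bakers map is the shift: the leading digit of
  \<open>future\<close> becomes the leading digit of \<open>past\<close>.\<close>

definition code_pt :: "(int \<Rightarrow> nat) \<Rightarrow> int \<Rightarrow> 'a" where
  "code_pt w k = pt (future w k) (past w k)"

definition full_seq :: "(int \<Rightarrow> nat) \<Rightarrow> bool" where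
  "full_seq w \<longleftrightarrow> (\<forall>k. w k < N)"

definition inner_digit :: "nat \<Rightarrow> bool" where
  "inner_digit i \<longleftrightarrow> 0 < i \<and> Suc i < N"

text \<open>Recurrence of inner digits in both directions keeps both coordinates strictly between 0
  and 1 at all times, so that the orbit stays off \<open>sing\<close>, where the value of the map is
  artificial.\<close>

definition good_seq :: "(int \<Rightarrow> nat) \<Rightarrow> bool" where
  "good_seq w \<longleftrightarrow> full_seq w \<and> (\<forall>k. \<exists>i\<ge>k. inner_digit (w i)) \<and> (\<forall>k. \<exists>i<k. inner_digit (w i))"

lemma two_le_N: "2 \<le> N" using N by simp

lemma full_seq_digits:
  assumes "full_seq w"
  shows "digits N (\<lambda>i. w (k + int i))" "digits N (\<lambda>i. w (k - 1 - int i))"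
  using assms by (auto simp: full_seq_def digits_def)

lemma future_rec:
  assumes "full_seq w"
  shows "real N * future w k = real (w k) + future w (k + 1)"
  using digit_value_rec'[OF two_le_N full_seq_digits(1)[OF assms, of k]]
  by (simp add: future_def algebra_simps)

lemma past_rec:
  assumes "full_seq w"
  shows "real N * past w k = real (w (k - 1)) + past w (k - 1)"
  using digit_value_rec'[OF two_le_N full_seq_digits(2)[OF assms, of k]]
  by (simp add: past_def algebra_simps)

lemma future_past_bounds:
  assumes "full_seq w"
  shows "0 \<le> future w k" "future w k \<le> 1" "0 \<le> past w k" "past w k \<le> 1"
  using digit_value_nonneg[OF two_le_N] digit_value_le_1[OF two_le_N] full_seq_digits[OF assms, of k]
  by (auto simp: future_def past_def)

lemma good_seq_bounds:
  assumes "good_seq w"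
  shows "0 < future w k" "future w k < 1" "0 < past w k" "past w k < 1"
proof -
  have full: "full_seq w" using assms by (simp add: good_seq_def)
  obtain i where "i \<ge> k" "inner_digit (w i)" using assms by (auto simp: good_seq_def)
  then have "inner_digit (w (k + int (nat (i - k))))" by simp
  then show "0 < future w k" "future w k < 1"
    unfolding future_def inner_digit_def
    using digit_value_pos[OF two_le_N full_seq_digits(1)[OF full, of k]]
      digit_value_less_1[OF two_le_N full_seq_digits(1)[OF full, of k]] by blast+
  obtain i where "i < k" "inner_digit (w i)" using assms by (auto simp: good_seq_def)
  then have "inner_digit (w (k - 1 - int (nat (k - 1 - i))))" by simp
  then show "0 < past w k" "past w k < 1"
    unfolding past_def inner_digit_def
    using digit_value_pos[OF two_le_N full_seq_digits(2)[OF full, of k]]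
      digit_value_less_1[OF two_le_N full_seq_digits(2)[OF full, of k]] by blast+
qed

lemma code_pt_in_square: "full_seq w \<Longrightarrow> code_pt w k \<in> unit_square"
  using future_past_bounds[of w k] by (simp add: code_pt_def)

lemma code_pt_in_strip: "full_seq w \<Longrightarrow> code_pt w k \<in> strip (w k)"
  using future_past_bounds[of w "k + 1"] future_past_bounds[of w k] future_rec[of w k] by (simp add: code_pt_def)

lemma code_pt_step:
  assumes "full_seq w" "code_pt w k \<notin> sing"
  shows "code_pt w k \<in> open_strip (w k)" "baker_map (code_pt w k) = code_pt w (k + 1)"
proof -
  have "w k < N" using assms(1) by (simp add: full_seq_def)
  then show *: "code_pt w k \<in> open_strip (w k)"
    using code_pt_in_strip[OF assms(1), of k] assms(2) strip_diff_sing[of "w k"] by blast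
  have "baker_map (code_pt w k) = pt (real N * future w k - real (w k)) ((past w k + real (w k)) / real N)"
    using * unfolding code_pt_def by (rule baker_map_open_strip)
  moreover have "past w (k + 1) = (past w k + real (w k)) / real N"
    using past_rec[OF assms(1), of "k + 1"] N by (simp add: field_simps)
  ultimately show "baker_map (code_pt w k) = code_pt w (k + 1)"
    using future_rec[OF assms(1), of k] by (simp add: code_pt_def)
qed

lemma good_code_pt_in_open_strip:
  assumes "good_seq w"
  shows "code_pt w k \<in> open_strip (w k)"
  using future_rec[of w k] assms good_seq_bounds[OF assms, of "k + 1"] good_seq_bounds[OF assms, of k]
  by (simp add: code_pt_def good_seq_def)

lemma good_code_pt_step:
  assumes "good_seq w"
  shows "baker_map (code_pt w k) = code_pt w (k + 1)"
proof (rule code_pt_step(2))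
  show "full_seq w" using assms by (simp add: good_seq_def)
  show "code_pt w k \<notin> sing"
    using good_code_pt_in_open_strip[OF assms, of k] open_strip_disjoint_sing by blast
qed

lemma good_code_pt_iterate:
  assumes "good_seq w"
  shows "(baker_map ^^ m) (code_pt w k) = code_pt w (k + int m)"
  by (induction m) (simp_all add: good_code_pt_step[OF assms] algebra_simps)

lemma code_pt_shift: "code_pt (\<lambda>i. w (i + m)) k = code_pt w (k + m)"
  by (simp add: code_pt_def future_def past_def algebra_simps)

lemma good_seq_shift:
  assumes "good_seq w"
  shows "good_seq (\<lambda>i. w (i + m))"
proof -
  have "\<exists>i\<ge>k. inner_digit (w (i + m))" for k
    using assms[unfolded good_seq_def] by (metis add.commute add_le_cancel_left diff_add_cancel)
  moreover have "\<exists>i<k. inner_digit (w (i + m))" for k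
    using assms[unfolded good_seq_def] by (metis add_less_cancel_right diff_add_cancel)
  ultimately show ?thesis using assms by (auto simp: good_seq_def full_seq_def)
qed

section \<open>Density of periodic points\<close>

lemma power_small:
  assumes "0 < \<epsilon>"
  obtains m where "2 / real N ^ m < \<epsilon>"
proof -
  obtain m where "2 / \<epsilon> < real N ^ m" using real_arch_pow[of "real N"] N by auto
  then have "2 / real N ^ m < \<epsilon>" using assms N by (simp add: field_simps)
  then show thesis by (rule that)
qed

lemma code_pt_prefix:
  assumes "full_seq w" "full_seq w'" "\<And>i. - int m \<le> i \<Longrightarrow> i < int m \<Longrightarrow> w i = w' i"
  shows "dist (code_pt w 0) (code_pt w' 0) \<le> 2 / real N ^ m"
proof -
  have "\<bar>future w 0 - future w' 0\<bar> \<le> 1 / real N ^ m"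
    unfolding future_def
    by (intro digit_value_prefix two_le_N full_seq_digits assms) auto
  moreover have "\<bar>past w 0 - past w' 0\<bar> \<le> 1 / real N ^ m"
    unfolding past_def
    by (intro digit_value_prefix two_le_N full_seq_digits assms) auto
  ultimately show ?thesis
    unfolding code_pt_def using dist_pt_le[of "future w 0" "past w 0" "future w' 0" "past w' 0"] by simp
qed

lemma code_pt_approx:
  assumes "v \<in> unit_square"
  obtains w where "full_seq w"
    "\<And>w'. full_seq w' \<Longrightarrow> (\<And>i. - int m \<le> i \<Longrightarrow> i < int m \<Longrightarrow> w' i = w i) \<Longrightarrow> dist (code_pt w' 0) v \<le> 2 / real N ^ m"
proof -
  obtain x y where v: "v = pt x y" "0 \<le> x" "x \<le> 1" "0 \<le> y" "y \<le> 1" using assms by (rule unit_squareE)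
  obtain s where s: "digits N s" "\<And>s'. digits N s' \<Longrightarrow> (\<forall>i<m. s' i = s i) \<Longrightarrow> \<bar>digit_value N s' - x\<bar> \<le> 1 / real N ^ m"
    using digit_value_approx[OF two_le_N v(2,3)] by blast
  obtain r where r: "digits N r" "\<And>s'. digits N s' \<Longrightarrow> (\<forall>i<m. s' i = r i) \<Longrightarrow> \<bar>digit_value N s' - y\<bar> \<le> 1 / real N ^ m"
    using digit_value_approx[OF two_le_N v(4,5)] by blast
  define w where "w i = (if 0 \<le> i then s (nat i) else r (nat (- 1 - i)))" for i
  show thesis
  proof (rule that)
    show "full_seq w" using s(1) r(1) by (simp add: full_seq_def digits_def w_def)
    fix w' assume w': "full_seq w'" "\<And>i. - int m \<le> i \<Longrightarrow> i < int m \<Longrightarrow> w' i = w i"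
    have "\<bar>future w' 0 - x\<bar> \<le> 1 / real N ^ m"
      unfolding future_def by (rule s(2)[OF full_seq_digits(1)[OF w'(1)]]) (simp add: w'(2) w_def)
    moreover have "\<bar>past w' 0 - y\<bar> \<le> 1 / real N ^ m"
      unfolding past_def by (rule r(2)[OF full_seq_digits(2)[OF w'(1)]]) (simp add: w'(2) w_def)
    ultimately show "dist (code_pt w' 0) v \<le> 2 / real N ^ m"
      unfolding code_pt_def v(1) using dist_pt_le[of "future w' 0" "past w' 0" x y] by simp
  qed
qed

lemma periodic_dense:
  assumes "v \<in> unit_square" "0 < \<epsilon>"
  obtains w P where "good_seq w" "0 < P" "dist (code_pt w 0) v < \<epsilon>" "(baker_map ^^ P) (code_pt w 0) = code_pt w 0"
proof -
  obtain m where m: "2 / real N ^ m < \<epsilon>" using power_small[OF assms(2)] .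
  obtain u where u: "full_seq u"
    "\<And>w'. full_seq w' \<Longrightarrow> (\<And>i. - int m \<le> i \<Longrightarrow> i < int m \<Longrightarrow> w' i = u i) \<Longrightarrow> dist (code_pt w' 0) v \<le> 2 / real N ^ m"
    using code_pt_approx[OF assms(1)] by blast
  \<comment> \<open>A block of \<open>2 * m\<close> digits copied from \<open>u\<close>, followed by
    one digit 1, which is inner and recurs and so makes the periodic sequence good. Residue
    \<open>r\<close> of \<open>i + m\<close> stands for position \<open>r - m\<close> of
    \<open>u\<close>.\<close>
  define P where "P = 2 * int m + 1"
  define w where "w i = (let r = (i + int m) mod P in if r = 2 * int m then 1 else u (r - int m))" for i
  have P: "0 < P" by (simp add: P_def)
  have full: "full_seq w" using u(1) N by (simp add: full_seq_def w_def Let_def)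
  have one: "w (int m + j * P) = 1" for j
  proof -
    have "(int m + j * P + int m) mod P = (2 * int m + j * P) mod P" by (simp add: algebra_simps)
    also have "\<dots> = 2 * int m" by (subst mod_mult_self1) (simp add: P_def)
    finally have "(int m + j * P + int m) mod P = 2 * int m" .
    then show ?thesis by (simp add: w_def)
  qed
  have "inner_digit 1" using N by (simp add: inner_digit_def)
  then have inner: "inner_digit (w (int m + j * P))" for j using one by simp
  have "\<exists>i\<ge>k. inner_digit (w i)" for k
  proof (rule exI, rule conjI[OF _ inner])
    have "k \<le> \<bar>k\<bar> * 1" by simp
    also have "\<dots> \<le> \<bar>k\<bar> * P" using P by (intro mult_left_mono) auto
    finally show "k \<le> int m + \<bar>k\<bar> * P" by simp
  qed
  moreover have "\<exists>i<k. inner_digit (w i)" for k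
  proof (rule exI, rule conjI[OF _ inner])
    define j where "j = \<bar>k\<bar> + int m + 1"
    have "j * 1 \<le> j * P" using P by (intro mult_left_mono) (auto simp: j_def)
    moreover have "int m - k < j" by (simp add: j_def)
    ultimately have "int m - j * P < k" by linarith
    then show "int m + (- (\<bar>k\<bar> + int m + 1)) * P < k"
      unfolding j_def[symmetric] by simp
  qed
  ultimately have good: "good_seq w" using full by (simp add: good_seq_def)
  moreover have "dist (code_pt w 0) v < \<epsilon>"
  proof -
    have "w i = u i" if "- int m \<le> i" "i < int m" for i
      using that by (simp add: w_def P_def mod_pos_pos_trivial)
    then show ?thesis using u(2)[OF full] m by force
  qed
  moreover have "(baker_map ^^ nat P) (code_pt w 0) = code_pt w 0"
  proof -
    have "w (i + P) = w i" for i
      by (simp add: w_def add.assoc add.commute[of P]) (simp add: add.assoc[symmetric])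
    then have "code_pt (\<lambda>i. w (i + P)) 0 = code_pt w 0" by simp
    then show ?thesis using P by (simp add: good_code_pt_iterate[OF good] code_pt_shift)
  qed
  ultimately show thesis using that P by (metis zero_less_nat_eq)
qed

text \<open>Periodic points are dense, and each returns to every neighbourhood that contains
  it.\<close>

lemma nonwandering_square: "nonwandering unit_square baker_map = unit_square"
proof -
  have "\<exists>k>0. (baker_map ^^ k) ` (unit_square \<inter> U) \<inter> U \<noteq> {}"
    if v: "v \<in> unit_square" "open U" "v \<in> U" for v U
  proof -
    obtain \<epsilon> where \<epsilon>: "0 < \<epsilon>" "ball v \<epsilon> \<subseteq> U" using v by (auto elim: openE)
    obtain w P where w: "good_seq w" "0 < P" "dist (code_pt w 0) v < \<epsilon>" "(baker_map ^^ P) (code_pt w 0) = code_pt w 0"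
      using periodic_dense[OF v(1) \<epsilon>(1)] .
    have "code_pt w 0 \<in> unit_square \<inter> U"
      using w(1,3) \<epsilon>(2) by (auto simp: good_seq_def dist_commute intro: code_pt_in_square)
    then have "code_pt w 0 \<in> (baker_map ^^ P) ` (unit_square \<inter> U) \<inter> U"
      using w(4) by (metis IntI IntD2 image_eqI)
    then show ?thesis using w(2) by blast
  qed
  then show ?thesis unfolding nonwandering_def by blast
qed

text \<open>Codes of good sequences are dense and lie off \<open>sing\<close>. This makes the
  interiors of different strips disjoint, as these can overlap only in \<open>sing\<close>.\<close>

lemma openin_square_meets:
  assumes "openin (top_of_set unit_square) W" "W \<noteq> {}"
  shows "\<not> W \<subseteq> sing"
proof -
  obtain v where v: "v \<in> W" "v \<in> unit_square" using assms openin_imp_subset by blast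
  obtain U where U: "open U" "W = unit_square \<inter> U" using assms(1) by (auto simp: openin_open)
  obtain \<epsilon> where \<epsilon>: "0 < \<epsilon>" "ball v \<epsilon> \<subseteq> U" using v U by (auto elim: openE)
  obtain w P where w: "good_seq w" "0 < (P::nat)" "dist (code_pt w 0) v < \<epsilon>"
    using periodic_dense[OF v(2) \<epsilon>(1)] by metis
  have "code_pt w 0 \<in> W"
    using w(1,3) \<epsilon>(2) unfolding U(2) by (auto simp: good_seq_def dist_commute intro: code_pt_in_square)
  moreover have "code_pt w 0 \<notin> sing"
    using good_code_pt_in_open_strip[OF w(1), of 0] open_strip_disjoint_sing by blast
  ultimately show ?thesis by blast
qed

section \<open>The strips as a generating Markov partition\<close>

lemma openin_open_strip: "i < N \<Longrightarrow> openin (top_of_set unit_square) (open_strip i)"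
  unfolding open_strip_def using N by (intro openin_open_rect) auto

lemma open_strip_subset_interior:
  "i < N \<Longrightarrow> open_strip i \<subseteq> (top_of_set unit_square) interior_of (strip i)"
  by (intro interior_of_maximal open_strip_subset_strip openin_open_strip)

lemma interior_strip_diff_sing:
  assumes "i < N"
  shows "(top_of_set unit_square) interior_of (strip i) - sing = open_strip i"
  using open_strip_subset_interior[OF assms] strip_diff_sing[OF assms] open_strip_disjoint_sing[of i]
    interior_of_subset[of "top_of_set unit_square" "strip i"] by blast

lemma strip_eq_closure_interior:
  assumes "i < N"
  shows "(top_of_set unit_square) closure_of ((top_of_set unit_square) interior_of (strip i)) = strip i"
proof
  have "closedin (top_of_set unit_square) (strip i)"
    using strip_subset_square[OF assms] by (intro closed_subset) (simp_all add: strip_def closed_cbox)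
  then show "(top_of_set unit_square) closure_of ((top_of_set unit_square) interior_of (strip i)) \<subseteq> strip i"
    by (intro closure_of_minimal interior_of_subset)
  have "strip i \<subseteq> unit_square \<inter> closure (open_strip i)"
    using strip_subset_square[OF assms] N
    by (simp add: open_strip_def strip_def closure_open_rect divide_strict_right_mono)
  also have "\<dots> \<subseteq> (top_of_set unit_square) closure_of (open_strip i)"
    using openin_imp_subset[OF openin_open_strip[OF assms]]
    by (simp add: closure_of_subtopology Int_absorb1)
  also have "\<dots> \<subseteq> (top_of_set unit_square) closure_of ((top_of_set unit_square) interior_of (strip i))"
    by (intro closure_of_mono open_strip_subset_interior assms)
  finally show "strip i \<subseteq> (top_of_set unit_square) closure_of ((top_of_set unit_square) interior_of (strip i))" .
qed

lemma open_strip_unique: "v \<in> open_strip i \<Longrightarrow> v \<in> open_strip j \<Longrightarrow> i = j"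
  by (auto elim!: open_stripE)

text \<open>Symbols of the \<beta>-shift start at 0, but strip 0 has to be spare. The permutation
  \<open>pos\<close>, from labels to strips, makes up for this offset.\<close>

context
  fixes pos :: "nat \<Rightarrow> nat"
  assumes pos: "bij_betw pos {..<N} {..<N}"
begin

abbreviation labelled_strip :: "nat \<Rightarrow> 'a set" where
  "labelled_strip j \<equiv> strip (pos j)"

lemma pos_less: "j < N \<Longrightarrow> pos j < N"
  using pos by (auto simp: bij_betw_def)

lemma regular_part_strip: "j < N \<Longrightarrow> regular_part unit_square sing labelled_strip j = open_strip (pos j)"
  unfolding regular_part_def by (rule interior_strip_diff_sing[OF pos_less])

lemma proper_partition_strips: "proper_partition unit_square {..<N} labelled_strip"
  unfolding proper_partition_def
proof (intro conjI ballI impI)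
  have "(\<Union>i<N. labelled_strip i) = (\<Union>i\<in>pos ` {..<N}. strip i)" by simp
  moreover have "pos ` {..<N} = {..<N}" using pos by (simp add: bij_betw_def)
  ultimately show "(\<Union>i<N. labelled_strip i) = unit_square"
    by (simp only: square_eq_strips)
  fix i assume i: "i \<in> {..<N}"
  then show "labelled_strip i = (top_of_set unit_square) closure_of ((top_of_set unit_square) interior_of labelled_strip i)"
    using strip_eq_closure_interior[OF pos_less] by simp
  fix j assume j: "j \<in> {..<N}" "i \<noteq> j"
  then have ne: "pos i \<noteq> pos j" using i pos by (auto simp: bij_betw_def inj_on_def)
  let ?W = "(top_of_set unit_square) interior_of labelled_strip i \<inter> (top_of_set unit_square) interior_of labelled_strip j"
  have "?W \<subseteq> sing"
    using interior_strip_diff_sing[OF pos_less] i j(1) ne open_strip_unique by fastforce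
  moreover have "openin (top_of_set unit_square) ?W"
    by (intro openin_Int openin_interior_of)
  ultimately show "?W = {}" using openin_square_meets by blast
qed simp

text \<open>Padding with the inner digit 1 embeds any finite word in a good sequence. Every word is
  therefore realised by an orbit off \<open>sing\<close>, and the coding subshift is the full
  shift.\<close>

lemma good_word:
  assumes "\<And>k. k \<le> n \<Longrightarrow> u k < N"
  shows "good_seq (\<lambda>i. if 0 \<le> i \<and> i \<le> int n then u (nat i) else 1)"
proof -
  have "inner_digit 1" using N by (simp add: inner_digit_def)
  moreover have "\<exists>i\<ge>k. \<not> (0 \<le> i \<and> i \<le> int n)" for k
    by (intro exI[of _ "max k (int n + 1)"]) auto
  moreover have "\<exists>i<k. \<not> (0 \<le> i \<and> i \<le> int n)" for k
    by (intro exI[of _ "min (k - 1) (- 1)"]) auto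
  ultimately show ?thesis
    using assms N unfolding good_seq_def full_seq_def by (auto; metis)
qed

lemma word_realised:
  assumes "\<And>k. k \<le> n \<Longrightarrow> u k < N"
  shows "\<exists>z. \<forall>k\<le>n. (baker_map ^^ k) z \<in> regular_part unit_square sing labelled_strip (u k)"
proof (intro exI allI impI)
  let ?w = "\<lambda>i. if 0 \<le> i \<and> i \<le> int n then pos (u (nat i)) else 1"
  have good: "good_seq ?w"
    using good_word[of n "\<lambda>k. pos (u k)"] assms pos_less by simp
  fix k assume k: "k \<le> n"
  have "(baker_map ^^ k) (code_pt ?w 0) = code_pt ?w (int k)"
    using good_code_pt_iterate[OF good, of k 0] by simp
  moreover have "code_pt ?w (int k) \<in> open_strip (pos (u k))"
    using good_code_pt_in_open_strip[OF good, of "int k"] k by simp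
  ultimately show "(baker_map ^^ k) (code_pt ?w 0) \<in> regular_part unit_square sing labelled_strip (u k)"
    using regular_part_strip assms k by simp
qed

lemma transition_strips:
  assumes "i < N" "j < N"
  shows "transition baker_map unit_square sing labelled_strip i j"
proof -
  have "\<exists>z. \<forall>k\<le>1. (baker_map ^^ k) z \<in> regular_part unit_square sing labelled_strip (if k = 0 then i else j)"
    by (rule word_realised) (use assms in auto)
  then obtain z where z: "\<forall>k\<le>1. (baker_map ^^ k) z \<in> regular_part unit_square sing labelled_strip (if k = 0 then i else j)"
    by blast
  show ?thesis unfolding transition_def using z[rule_format, of 0] z[rule_format, of 1] by auto
qed

lemma coding_sft_full: "coding_sft baker_map unit_square sing {..<N} labelled_strip = {t. full_seq t}"
  by (auto simp: coding_sft_def full_seq_def transition_strips)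

text \<open>Each step expands horizontal distances inside a strip by \<open>N\<close>, so following
  the same strips for longer pins down the first coordinate.\<close>

lemma future_of_itinerary:
  assumes "z \<in> unit_square" "digits N s" "\<And>j. j < m \<Longrightarrow> (baker_map ^^ j) z \<in> open_strip (s j)"
  shows "\<bar>z \<bullet> e1 - digit_value N s\<bar> \<le> 1 / real N ^ m"
  using assms
proof (induction m arbitrary: z s)
  case 0
  then show ?case
    using digit_value_nonneg[OF two_le_N 0(2)] digit_value_le_1[OF two_le_N 0(2)] by (auto elim!: unit_squareE)
next
  case (Suc m)
  let ?s = "\<lambda>i. s (Suc i)"
  have "z \<in> open_strip (s 0)" using Suc.prems(3)[of 0] by simp
  then obtain x y where xy: "z = pt x y" "pt x y \<in> open_strip (s 0)" by (auto elim!: open_stripE)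
  have "\<bar>baker_map z \<bullet> e1 - digit_value N ?s\<bar> \<le> 1 / real N ^ m"
  proof (rule Suc.IH)
    show "baker_map z \<in> unit_square" using Suc.prems(1) baker_map_image by blast
    show "digits N ?s" using Suc.prems(2) by (simp add: digits_def)
    show "(baker_map ^^ j) (baker_map z) \<in> open_strip (s (Suc j))" if "j < m" for j
      using Suc.prems(3)[of "Suc j"] that by (simp add: funpow_swap1)
  qed
  moreover have "baker_map z \<bullet> e1 = real N * x - real (s 0)"
    unfolding xy(1) baker_map_open_strip[OF xy(2)] by simp
  ultimately have "\<bar>real N * (x - digit_value N s)\<bar> \<le> 1 / real N ^ m"
    using digit_value_rec'[OF two_le_N Suc.prems(2)] by (simp add: algebra_simps)
  then show ?case using abs_le_inverse_power_Suc[OF two_le_N] by (simp add: xy(1))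
qed

text \<open>Each step contracts vertical distances inside a strip by \<open>N\<close>, so the height
  at which the segment began is forgotten. Time \<open>k\<close> belongs to the end of the segment,
  hence the offset \<open>k - m\<close>.\<close>

lemma past_of_itinerary:
  assumes "z \<in> unit_square" "full_seq w" "\<And>j. j < m \<Longrightarrow> (baker_map ^^ j) z \<in> open_strip (w (k - int m + int j))"
  shows "\<bar>(baker_map ^^ m) z \<bullet> e2 - past w k\<bar> \<le> 1 / real N ^ m"
  using assms
proof (induction m arbitrary: k)
  case 0
  then show ?case
    using future_past_bounds[OF 0(2), of k] by (auto elim!: unit_squareE)
next
  case (Suc m)
  let ?z = "(baker_map ^^ m) z"
  have IH: "\<bar>?z \<bullet> e2 - past w (k - 1)\<bar> \<le> 1 / real N ^ m"
  proof (rule Suc.IH)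
    show "(baker_map ^^ j) z \<in> open_strip (w (k - 1 - int m + int j))" if "j < m" for j
      using Suc.prems(3)[of j] that by (simp add: algebra_simps)
  qed (use Suc.prems in auto)
  have "?z \<in> open_strip (w (k - 1))" using Suc.prems(3)[of m] by simp
  then obtain x y where xy: "?z = pt x y" "pt x y \<in> open_strip (w (k - 1))" by (auto elim!: open_stripE)
  have "(baker_map ^^ Suc m) z \<bullet> e2 = (y + real (w (k - 1))) / real N"
    using baker_map_open_strip[OF xy(2)] by (simp add: xy(1))
  then have "real N * ((baker_map ^^ Suc m) z \<bullet> e2 - past w k) = ?z \<bullet> e2 - past w (k - 1)"
    using past_rec[OF Suc.prems(2), of k] N by (simp add: right_diff_distrib xy(1))
  then show ?case using IH by (intro abs_le_inverse_power_Suc[OF two_le_N]) simp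
qed

text \<open>The point coded by \<open>t\<close> may lie on \<open>sing\<close> and then belongs to
  no cylinder. It still lies in their closures, as a limit of codes of good sequences that agree
  with \<open>t\<close> on long windows.\<close>

lemma closed_cylinders_meet:
  assumes "full_seq t"
  shows "(\<Inter>m. closure (cylinder baker_map unit_square sing labelled_strip t m)) = {code_pt (\<lambda>k. pos (t k)) 0}"
proof
  let ?w = "\<lambda>k. pos (t k)"
  let ?C = "cylinder baker_map unit_square sing labelled_strip t"
  have t: "t k < N" for k using assms by (simp add: full_seq_def)
  have full: "full_seq ?w" using pos_less t by (simp add: full_seq_def)
  have C: "?C m = {(baker_map ^^ m) z |z. \<forall>j\<le>2 * m. (baker_map ^^ j) z \<in> open_strip (?w (int j - int m))}" for m
    unfolding cylinder_def using regular_part_strip[OF t] by simp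
  show "(\<Inter>m. closure (?C m)) \<subseteq> {code_pt ?w 0}"
  proof
    fix v assume v: "v \<in> (\<Inter>m. closure (?C m))"
    have near: "dist v (code_pt ?w 0) \<le> 2 / real N ^ m" for m
    proof -
      have "?C m \<subseteq> cball (code_pt ?w 0) (2 / real N ^ m)"
      proof
        fix u assume "u \<in> ?C m"
        then obtain z where z: "u = (baker_map ^^ m) z" "\<And>j. j \<le> 2 * m \<Longrightarrow> (baker_map ^^ j) z \<in> open_strip (?w (int j - int m))"
          unfolding C by blast
        have it: "(baker_map ^^ j) z \<in> unit_square" if "j \<le> 2 * m" for j
          using z(2)[OF that] full open_strip_subset_strip strip_subset_square unfolding full_seq_def by blast
        have "\<bar>u \<bullet> e1 - future ?w 0\<bar> \<le> 1 / real N ^ m"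
          unfolding future_def
        proof (rule future_of_itinerary)
          show "u \<in> unit_square" using it[of m] z(1) by simp
          show "digits N (\<lambda>i. ?w (0 + int i))" using full_seq_digits(1)[OF full, of 0] by simp
          show "(baker_map ^^ j) u \<in> open_strip (?w (0 + int j))" if "j < m" for j
            using z(2)[of "j + m"] that unfolding z(1) by (simp add: funpow_add)
        qed
        moreover have "\<bar>u \<bullet> e2 - past ?w 0\<bar> \<le> 1 / real N ^ m"
          unfolding z(1)
        proof (rule past_of_itinerary)
          show "z \<in> unit_square" using it[of 0] by simp
          show "(baker_map ^^ j) z \<in> open_strip (?w (0 - int m + int j))" if "j < m" for j
            using z(2)[of j] that by (simp add: algebra_simps)
        qed (rule full)
        moreover have "u = pt (u \<bullet> e1) (u \<bullet> e2)"
          using it[of m] z(1) by (auto elim!: unit_squareE)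
        ultimately show "u \<in> cball (code_pt ?w 0) (2 / real N ^ m)"
          using dist_pt_le[of "u \<bullet> e1" "u \<bullet> e2" "future ?w 0" "past ?w 0"]
          by (simp add: code_pt_def dist_commute)
      qed
      then have "closure (?C m) \<subseteq> cball (code_pt ?w 0) (2 / real N ^ m)"
        by (intro closure_minimal) auto
      then show ?thesis using v by (auto simp: dist_commute)
    qed
    have "v = code_pt ?w 0"
    proof (rule ccontr)
      assume "v \<noteq> code_pt ?w 0"
      then obtain m where "2 / real N ^ m < dist v (code_pt ?w 0)" using power_small[of "dist v (code_pt ?w 0)"] by auto
      then show False using near[of m] by simp
    qed
    then show "v \<in> {code_pt ?w 0}" by simp
  qed
  show "{code_pt ?w 0} \<subseteq> (\<Inter>m. closure (?C m))"
  proof -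
    have "code_pt ?w 0 \<in> closure (?C m)" for m
      unfolding closure_approachable
    proof (intro allI impI)
      fix \<epsilon> :: real assume "0 < \<epsilon>"
      then obtain K where K: "2 / real N ^ K < \<epsilon>" by (rule power_small)
      \<comment> \<open>The window has to cover \<open>K\<close>, for closeness to the point, and
        \<open>m\<close>, for membership in the cylinder.\<close>
      define n where "n = max K (Suc m)"
      define w' where "w' i = (if - int n \<le> i \<and> i \<le> int n then ?w i else 1)" for i
      \<comment> \<open>\<open>good_word\<close> places its word at time 0; the shift by
        \<open>n\<close> below centres the window.\<close>
      have "good_seq (\<lambda>i. if 0 \<le> i \<and> i \<le> int (2 * n) then ?w (int (nat i) - int n) else 1)"
        by (rule good_word[of "2 * n" "\<lambda>i. ?w (int i - int n)"]) (use pos_less t in auto)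
      then have "good_seq (\<lambda>i. (if 0 \<le> i + int n \<and> i + int n \<le> int (2 * n) then ?w (int (nat (i + int n)) - int n) else 1))"
        by (rule good_seq_shift)
      also have "(\<lambda>i. (if 0 \<le> i + int n \<and> i + int n \<le> int (2 * n) then ?w (int (nat (i + int n)) - int n) else 1)) = w'"
        by (auto simp: w'_def fun_eq_iff)
      finally have good: "good_seq w'" .
      have "dist (code_pt w' 0) (code_pt ?w 0) \<le> 2 / real N ^ K"
        using good full by (intro code_pt_prefix) (auto simp: w'_def good_seq_def n_def)
      moreover have "code_pt w' 0 \<in> ?C m"
      proof -
        have it: "(baker_map ^^ j) (code_pt w' (- int m)) = code_pt w' (int j - int m)" for j
          using good_code_pt_iterate[OF good, of j "- int m"] by simp
        have "(baker_map ^^ j) (code_pt w' (- int m)) \<in> open_strip (?w (int j - int m))" if "j \<le> 2 * m" for j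
          using good_code_pt_in_open_strip[OF good, of "int j - int m"] that
          unfolding it by (auto simp: w'_def n_def split: if_splits)
        moreover have "code_pt w' 0 = (baker_map ^^ m) (code_pt w' (- int m))" using it[of m] by simp
        ultimately show ?thesis unfolding C by blast
      qed
      ultimately show "\<exists>y\<in>?C m. dist y (code_pt ?w 0) < \<epsilon>" using K by force
    qed
    then show ?thesis by blast
  qed
qed

lemma coding_map_strips:
  assumes "full_seq t"
  shows "coding_map baker_map unit_square sing labelled_strip t = code_pt (\<lambda>k. pos (t k)) 0"
  unfolding coding_map_def closed_cylinders_meet[OF assms] by auto

lemma generating_markov_partition_strips:
  "generating_markov_partition baker_map unit_square sing {..<N} labelled_strip"
  unfolding generating_markov_partition_def coding_sft_full
  using proper_partition_strips word_realised closed_cylinders_meet by auto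

end

end

subsection \<open>Stable and unstable pieces\<close>

context baker
begin

lemma digit_value_le_iff_lex_le:
  assumes "\<And>i. inner_digit (s i)" "\<And>i. inner_digit (u i)"
  shows "digit_value N s \<le> digit_value N u \<longleftrightarrow> lex_le s u"
proof -
  have d: "digits N s" "digits N u" "\<And>i. Suc (s i) < N" "\<And>i. Suc (u i) < N"
    using assms unfolding digits_def inner_digit_def by (auto simp: Suc_lessD)
  show ?thesis
  proof
    assume "digit_value N s \<le> digit_value N u"
    then show "lex_le s u"
      using digit_value_lex_less[OF two_le_N d(2,1,4)] not_lex_le[of s u] by (metis linorder_not_le)
  next
    assume "lex_le s u"
    then show "digit_value N s \<le> digit_value N u"
      using digit_value_lex_less[OF two_le_N d(1,2,3)] unfolding lex_le_def by (metis less_imp_le order_refl)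
  qed
qed

text \<open>The constant sequences 1 and \<open>N - 2\<close> are extremal. The bounds confine inner
  sequences to the rectangle on three sides and keep their points at a uniform distance from
  0.\<close>

lemma inner_digit_value_bounds:
  assumes "\<And>i. inner_digit (s i)"
  shows "1 / real (N - 1) \<le> digit_value N s" "digit_value N s \<le> real (N - 2) / real (N - 1)"
proof -
  have i: "s i < N" "1 \<le> s i" "s i \<le> N - 2" for i
    using assms[of i] by (auto simp: inner_digit_def)
  have "digit_value N (\<lambda>_. 1) \<le> digit_value N s" "digit_value N s \<le> digit_value N (\<lambda>_. N - 2)"
    using i N by (auto intro!: digit_value_mono[OF two_le_N] simp: digits_def)
  then show "1 / real (N - 1) \<le> digit_value N s" "digit_value N s \<le> real (N - 2) / real (N - 1)"
    using N by (simp_all add: digit_value_const[OF two_le_N])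
qed

lemma inner_seq_good:
  assumes "\<And>k. inner_digit (w k)"
  shows "good_seq w"
  unfolding good_seq_def full_seq_def
proof (intro conjI allI)
  show "w k < N" for k using assms[of k] by (simp add: inner_digit_def)
  show "\<exists>i\<ge>k. inner_digit (w i)" for k using assms by blast
  show "\<exists>i<k. inner_digit (w i)" for k using assms by (intro exI[of _ "k - 1"]) simp
qed

section \<open>Points with N-adic coordinates, and the sides of the rectangle\<close>

lemma adic_approx:
  assumes "0 \<le> x" "x \<le> 1"
  shows "\<exists>u. 0 < u \<and> u \<le> 1 \<and> \<bar>u - x\<bar> \<le> 1 / real N ^ k \<and> real N ^ k * u \<in> \<int>"
proof -
  define K where "K = real N ^ k"
  have K: "1 \<le> K" using N by (simp add: K_def)
  have K_floor: "\<lfloor>K * x\<rfloor> \<le> K" "0 \<le> K * x" "K * x \<le> K"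
  proof -
    show "0 \<le> K * x" "K * x \<le> K" using assms K by (auto simp: mult_left_le)
    then show "\<lfloor>K * x\<rfloor> \<le> K" by linarith
  qed
  \<comment> \<open>The maximum forces \<open>u > 0\<close>. If the floor is 0, then
    \<open>K * x\<close> lies in [0, 1) and hence within distance 1 of \<open>j = 1\<close>.\<close>
  define j where "j = max 1 \<lfloor>K * x\<rfloor>"
  define u where "u = of_int j / K"
  have "0 < u" "u \<le> 1" using K K_floor by (auto simp: u_def j_def)
  moreover have Ku: "K * u = of_int j" using K by (simp add: u_def)
  moreover have "\<bar>u - x\<bar> \<le> 1 / K"
  proof -
    have "\<bar>of_int j - K * x\<bar> \<le> 1" using K_floor unfolding j_def by linarith
    moreover have "of_int j - K * x = K * (u - x)" using Ku by (simp add: algebra_simps)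
    ultimately have "K * \<bar>u - x\<bar> \<le> 1" using K by (simp add: abs_mult)
    then show ?thesis using K by (simp add: field_simps)
  qed
  ultimately show ?thesis unfolding K_def by (metis Ints_of_int)
qed

lemma adic_dense:
  assumes "openin (top_of_set unit_square) W" "W \<noteq> {}"
  obtains k u w where "pt u w \<in> W" "0 < u" "0 < w" "real N ^ k * u \<in> \<int>" "real N ^ k * w \<in> \<int>"
proof -
  obtain v where v: "v \<in> W" "v \<in> unit_square" using assms openin_imp_subset by blast
  obtain U where U: "open U" "W = unit_square \<inter> U" using assms(1) by (auto simp: openin_open)
  obtain \<epsilon> where \<epsilon>: "0 < \<epsilon>" "ball v \<epsilon> \<subseteq> U" using v U by (auto elim: openE)
  obtain k where k: "2 / real N ^ k < \<epsilon>" using power_small[OF \<epsilon>(1)] .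
  obtain x y where xy: "v = pt x y" "0 \<le> x" "x \<le> 1" "0 \<le> y" "y \<le> 1" using v(2) by (rule unit_squareE)
  obtain u where u: "0 < u" "u \<le> 1" "\<bar>u - x\<bar> \<le> 1 / real N ^ k" "real N ^ k * u \<in> \<int>"
    using adic_approx[OF xy(2,3)] by blast
  obtain w where w: "0 < w" "w \<le> 1" "\<bar>w - y\<bar> \<le> 1 / real N ^ k" "real N ^ k * w \<in> \<int>"
    using adic_approx[OF xy(4,5)] by blast
  have "dist (pt u w) v < \<epsilon>"
    using dist_pt_le[of u w x y] u(3) w(3) k unfolding xy(1) by simp
  then have "pt u w \<in> W" using \<epsilon>(2) u w unfolding U(2) by (auto simp: dist_commute)
  then show thesis using that u w by blast
qed

lemma baker_map_0: "(baker_map ^^ k) 0 = 0"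
  by (induction k) (simp_all add: baker_map_sing[OF zero_in_sing])

text \<open>Each step off \<open>sing\<close> multiplies the first coordinate by \<open>N\<close> up
  to an integer and so removes a power of \<open>N\<close> from the denominator. Eventually the
  point lies on \<open>sing\<close>, is sent to 0 and stays there.\<close>

lemma adic_falls_to_0:
  assumes "v \<in> unit_square" "real N ^ k * (v \<bullet> e1) \<in> \<int>" "k < i"
  shows "(baker_map ^^ i) v = 0"
proof -
  have "(baker_map ^^ Suc k) v = 0"
    using assms(1,2)
  proof (induction k arbitrary: v)
    case 0
    then have "v \<in> sing" by (auto simp: sing_def)
    then show ?case by (simp add: baker_map_sing)
  next
    case (Suc k)
    show ?case
    proof (cases "v \<in> sing")
      case True
      then show ?thesis
        using baker_map_0[of "Suc k"] by (simp add: funpow_Suc_right baker_map_sing del: funpow.simps)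
    next
      case False
      then obtain i where i: "v \<in> open_strip i" using Suc.prems(1) square_diff_sing by blast
      then obtain x y where xy: "v = pt x y" "pt x y \<in> open_strip i" by (auto elim!: open_stripE)
      have "real N ^ k * (baker_map v \<bullet> e1) = real N ^ Suc k * x - real N ^ k * real i"
        unfolding xy(1) baker_map_open_strip[OF xy(2)] by (simp add: algebra_simps)
      also have "\<dots> \<in> \<int>" using Suc.prems(2) by (simp add: xy(1))
      finally have "(baker_map ^^ Suc k) (baker_map v) = 0"
        using Suc.IH Suc.prems(1) baker_map_image by blast
      then show ?thesis by (simp add: funpow_Suc_right del: funpow.simps)
    qed
  qed
  moreover have "(baker_map ^^ i) v = (baker_map ^^ (i - Suc k)) ((baker_map ^^ Suc k) v)"
    using assms(3) by (metis Suc_leI comp_apply funpow_add le_add_diff_inverse2)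
  ultimately show ?thesis by (simp add: baker_map_0 del: funpow.simps)
qed

lemma preimage_not_sing:
  assumes "baker_map v \<noteq> 0"
  shows "v \<notin> sing"
  using assms baker_map_sing by blast

text \<open>Going backwards multiplies the second coordinate by \<open>N\<close> up to an integer,
  so it would become an integer after \<open>k\<close> steps. But \<open>sing\<close> is mapped to
  0, so a nonzero point with a preimage is in the image of a branch, where the second coordinate is
  strictly between 0 and 1.\<close>

lemma adic_no_backward_orbit:
  assumes "\<And>i. q i \<in> unit_square \<and> baker_map (q (Suc i)) = q i"
    and "q 0 \<noteq> 0" "real N ^ k * (q 0 \<bullet> e2) \<in> \<int>"
  shows False
  using assms
proof (induction k arbitrary: q)
  have step: "\<exists>i x y. i < N \<and> q (Suc 0) = pt x y \<and> 0 < y \<and> y < 1 \<and> q 0 \<bullet> e2 = (y + real i) / real N"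
    if q: "\<And>i. q i \<in> unit_square \<and> baker_map (q (Suc i)) = q i" "q 0 \<noteq> 0" for q
  proof -
    have "q (Suc 0) \<notin> sing" using q preimage_not_sing by metis
    then obtain i where i: "i < N" "q (Suc 0) \<in> open_strip i" using q(1) square_diff_sing by blast
    obtain x y where xy: "q (Suc 0) = pt x y" "0 < y" "y < 1"
      using i(2) by (rule open_stripE)
    then have "q 0 = pt (real N * x - real i) ((y + real i) / real N)"
      using baker_map_open_strip[of x y i] i(2) q(1)[of 0] by simp
    then show ?thesis using i(1) xy by auto
  qed
  {
    case 0
    obtain i x y where i: "i < N" "0 < y" "y < 1" "q 0 \<bullet> e2 = (y + real i) / real N"
      using step[OF 0(1,2)] by blast
    have "real i + 1 \<le> real N" using i(1) by linarith
    then have "0 < q 0 \<bullet> e2" "q 0 \<bullet> e2 < 1" using i by auto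
    then have "q 0 \<bullet> e2 \<notin> \<int>" using not_int_between[of 0] by simp
    then show ?case using 0(3) by simp
  next
    case (Suc k)
    obtain i x y where i: "q (Suc 0) = pt x y" "0 < y" "y < 1" "q 0 \<bullet> e2 = (y + real i) / real N"
      using step[OF Suc.prems(1,2)] by blast
    show ?case
    proof (rule Suc.IH[of "\<lambda>j. q (Suc j)"])
      show "q (Suc j) \<in> unit_square \<and> baker_map (q (Suc (Suc j))) = q (Suc j)" for j
        using Suc.prems(1) by blast
      show "q (Suc 0) \<noteq> 0" using i by simp
      have "real N ^ k * (q (Suc 0) \<bullet> e2) = real N ^ Suc k * (q 0 \<bullet> e2) - real N ^ k * real i"
      proof -
        have "real N ^ Suc k * (q 0 \<bullet> e2) = real N ^ k * (real N * (q 0 \<bullet> e2))" by simp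
        also have "real N * (q 0 \<bullet> e2) = y + real i" using i(4) N by simp
        finally show ?thesis using i(1) by (simp add: algebra_simps)
      qed
      also have "\<dots> \<in> \<int>" using Suc.prems(3) by simp
      finally show "real N ^ k * (q (Suc 0) \<bullet> e2) \<in> \<int>" .
    qed
  }
qed

text \<open>Points on one vertical line share the digits of the first coordinate, hence pass through
  the same strips, and their distance shrinks by \<open>N\<close> at each step. The strict bounds
  keep both orbits off \<open>sing\<close>.\<close>

lemma vertical_orbits:
  assumes s: "\<And>i. inner_digit (s i)" and y: "0 < y" "y < 1" "0 < y'" "y' < 1"
  shows "\<exists>v v'. 0 < v \<and> v < 1 \<and> 0 < v' \<and> v' < 1 \<and> \<bar>v - v'\<bar> = \<bar>y - y'\<bar> / real N ^ k \<and>
    (baker_map ^^ k) (pt (digit_value N s) y) = pt (digit_value N (\<lambda>i. s (k + i))) v \<and>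
    (baker_map ^^ k) (pt (digit_value N s) y') = pt (digit_value N (\<lambda>i. s (k + i))) v'"
proof (induction k)
  case 0
  then show ?case using y by auto
next
  case (Suc k)
  let ?x = "\<lambda>k. digit_value N (\<lambda>i. s (k + i))"
  obtain v v' where v: "0 < v" "v < 1" "0 < v'" "v' < 1" "\<bar>v - v'\<bar> = \<bar>y - y'\<bar> / real N ^ k"
    "(baker_map ^^ k) (pt (digit_value N s) y) = pt (?x k) v"
    "(baker_map ^^ k) (pt (digit_value N s) y') = pt (?x k) v'"
    using Suc by blast
  have dig: "digits N (\<lambda>i. s (k + i))" for k
    using s by (auto simp: digits_def inner_digit_def Suc_lessD)
  have x_rec: "real N * ?x k = real (s k) + ?x (Suc k)"
    using digit_value_rec'[OF two_le_N dig[of k]] by simp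
  have x_bounds: "0 < ?x (Suc k)" "?x (Suc k) < 1"
    using digit_value_pos[OF two_le_N dig[of "Suc k"], of 0] digit_value_less_1[OF two_le_N dig[of "Suc k"], of 0]
      s[of "Suc k"] by (auto simp: inner_digit_def)
  have step: "baker_map (pt (?x k) u) = pt (?x (Suc k)) ((u + real (s k)) / real N)" if "0 < u" "u < 1" for u
    using that x_bounds x_rec by (subst baker_map_open_strip[of _ _ "s k"]) auto
  have range: "0 < (u + real (s k)) / real N" "(u + real (s k)) / real N < 1" if "0 < u" "u < 1" for u
  proof -
    have "real (s k) + 1 \<le> real N" using s[of k] unfolding inner_digit_def by linarith
    then show "0 < (u + real (s k)) / real N" "(u + real (s k)) / real N < 1" using that N by auto
  qed
  have "(v + real (s k)) / real N - (v' + real (s k)) / real N = (v - v') / real N"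
    by (simp add: diff_divide_distrib[symmetric])
  then have "\<bar>(v + real (s k)) / real N - (v' + real (s k)) / real N\<bar> = \<bar>y - y'\<bar> / real N ^ Suc k"
    using v(5) N by (simp add: abs_divide mult.commute)
  then show ?case
    using v step range
    by (intro exI[of _ "(v + real (s k)) / real N"] exI[of _ "(v' + real (s k)) / real N"]) simp
qed

text \<open>If the stable set had interior, it would contain an N-adic point, whose orbit ends at 0,
  while the orbit of \<open>?x\<close> keeps its first coordinate at least
  \<open>1 / (N - 1)\<close>. As \<open>s\<close> is any sequence of inner digits, both vertical
  sides are covered.\<close>

lemma vertical_piece:
  assumes s: "\<And>i. inner_digit (s i)" and cd: "0 < c" "c < d" "d < 1"
  shows "invariant_manifold_piece unit_square baker_map (linepath (pt (digit_value N s) c) (pt (digit_value N s) d))"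
proof -
  let ?x = "pt (digit_value N s) c"
  let ?W = "stable_set unit_square baker_map ?x"
  have dig: "digits N s" using s by (auto simp: digits_def inner_digit_def Suc_lessD)
  have sq: "pt (digit_value N s) y \<in> unit_square" if "y \<in> {c..d}" for y
    using that cd digit_value_nonneg[OF two_le_N dig] digit_value_le_1[OF two_le_N dig] by simp
  have "pt (digit_value N s) y \<in> ?W" if y: "y \<in> {c..d}" for y
    unfolding stable_set_def
  proof (intro CollectI conjI sq[OF y])
    have le: "dist ((baker_map ^^ k) ?x) ((baker_map ^^ k) (pt (digit_value N s) y)) \<le> \<bar>c - y\<bar> / real N ^ k" for k
    proof -
      obtain v v' where "\<bar>v - v'\<bar> = \<bar>c - y\<bar> / real N ^ k"
        "(baker_map ^^ k) ?x = pt (digit_value N (\<lambda>i. s (k + i))) v"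
        "(baker_map ^^ k) (pt (digit_value N s) y) = pt (digit_value N (\<lambda>i. s (k + i))) v'"
        using vertical_orbits[of s c y k, OF s] y cd by auto
      then show ?thesis using dist_pt_le[of _ v _ v'] by (metis abs_0 add_0 cancel_comm_monoid_add_class.diff_cancel)
    qed
    have lim: "(\<lambda>k. \<bar>c - y\<bar> / real N ^ k) \<longlonglongrightarrow> 0"
      using N by (intro LIMSEQ_divide_realpow_zero) simp
    show "(\<lambda>k. dist ((baker_map ^^ k) ?x) ((baker_map ^^ k) (pt (digit_value N s) y))) \<longlonglongrightarrow> 0"
      by (rule Lim_null_comparison[OF _ lim]) (simp only: real_norm_def abs_of_nonneg[OF zero_le_dist] le eventually_True)
  qed
  then have "path_image (linepath ?x (pt (digit_value N s) d)) \<subseteq> ?W"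
    using cd by (auto simp: closed_segment_pt closed_segment_eq_real_ivl)
  moreover have "(top_of_set unit_square) interior_of ?W = {}"
  proof (rule ccontr)
    assume "\<not> ?thesis"
    from adic_dense[OF openin_interior_of this]
    obtain k u w where uw: "pt u w \<in> (top_of_set unit_square) interior_of ?W" "real N ^ k * u \<in> \<int>" .
    have W: "pt u w \<in> ?W" by (rule subsetD[OF interior_of_subset uw(1)])
    then have "(\<lambda>i. dist ((baker_map ^^ i) ?x) ((baker_map ^^ i) (pt u w))) \<longlonglongrightarrow> 0"
      by (simp add: stable_set_def)
    moreover have "\<forall>\<^sub>F i in sequentially. 1 / real (N - 1) \<le> dist ((baker_map ^^ i) ?x) ((baker_map ^^ i) (pt u w))"
      using eventually_gt_at_top[of k]
    proof eventually_elim
      case (elim i)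
      have "(baker_map ^^ i) (pt u w) = 0"
        using W uw(2) elim by (intro adic_falls_to_0) (auto simp: stable_set_def)
      moreover obtain v where "(baker_map ^^ i) ?x = pt (digit_value N (\<lambda>j. s (i + j))) v"
        using vertical_orbits[of s c c i, OF s] cd by auto
      moreover have "1 / real (N - 1) \<le> digit_value N (\<lambda>j. s (i + j))"
        by (rule inner_digit_value_bounds(1)[OF s])
      ultimately have "1 / real (N - 1) \<le> \<bar>(baker_map ^^ i) ?x \<bullet> e1 - (baker_map ^^ i) (pt u w) \<bullet> e1\<bar>"
        by (simp only: inner_pt inner_zero_left diff_zero abs_ge_self[THEN order_trans[rotated]])
      also have "\<dots> \<le> dist ((baker_map ^^ i) ?x) ((baker_map ^^ i) (pt u w))"
        by (rule abs_inner_diff_le(1))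
      finally show ?case .
    qed
    ultimately have "1 / real (N - 1) \<le> 0" by (rule tendsto_lowerbound) simp
    then show False using N by simp
  qed
  ultimately show ?thesis
    unfolding invariant_manifold_piece_def nonwandering_square
    using cd sq[of c] finite_length_linepath by (auto simp: arc_linepath)
qed

text \<open>At the height fixed by branch \<open>j\<close>, the inverse branch maps the line into
  itself and contracts it, which gives asymptotic backward orbits. Interior of the unstable set
  would contain a point of positive N-adic height, which has no backward orbit.\<close>

lemma horizontal_piece:
  assumes j: "inner_digit j" and y: "y = real j / real (N - 1)" and ab: "0 < a" "a < b" "b < 1"
  shows "invariant_manifold_piece unit_square baker_map (linepath (pt a y) (pt b y))"
proof -
  let ?W = "unstable_set unit_square baker_map (pt a y)"
  have jN: "1 \<le> real j" "real j + 2 \<le> real N" "real j < real (N - 1)"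
    using j unfolding inner_digit_def by linarith+
  have y01: "0 < y" "y < 1" using jN N unfolding y by auto
  have fixed: "(y + real j) / real N = y"
    using N unfolding y by (simp add: field_simps of_nat_diff)
  \<comment> \<open>The first coordinate of the inverse of the branch over strip
    \<open>j\<close>.\<close>
  define g where "g x = (x + real j) / real N" for x
  have g01: "0 < (g ^^ k) x \<and> (g ^^ k) x < 1" if "0 < x" "x < 1" for k x
    using that jN N by (induction k) (auto simp: g_def)
  have step: "baker_map (pt (g x) y) = pt x y" if "0 < x" "x < 1" for x
    using that y01 N fixed by (subst baker_map_open_strip[of _ _ j]) (auto simp: g_def)
  have contract: "\<bar>(g ^^ k) x - (g ^^ k) x'\<bar> = \<bar>x - x'\<bar> / real N ^ k" for k x x'
  proof (induction k)
    case (Suc k)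
    have "g u - g u' = (u - u') / real N" for u u'
      by (simp add: g_def diff_divide_distrib[symmetric])
    then show ?case using Suc N by (simp add: mult.commute)
  qed simp
  have sq: "pt x y \<in> unit_square" if "0 < x" "x < 1" for x
    using that y01 by simp
  have "pt x y \<in> ?W" if x: "x \<in> {a..b}" for x
    unfolding unstable_set_def
  proof (rule CollectI, rule exI[of _ "\<lambda>k. pt ((g ^^ k) a) y"], rule exI[of _ "\<lambda>k. pt ((g ^^ k) x) y"], intro conjI allI)
    have x01: "0 < x" "x < 1" "0 < a" "a < 1" using x ab by auto
    have le: "dist (pt ((g ^^ k) a) y) (pt ((g ^^ k) x) y) \<le> \<bar>a - x\<bar> / real N ^ k" for k
      using dist_pt_le[of "(g ^^ k) a" y "(g ^^ k) x" y] contract[of k a x] by simp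
    have lim: "(\<lambda>k. \<bar>a - x\<bar> / real N ^ k) \<longlonglongrightarrow> 0"
      using N by (intro LIMSEQ_divide_realpow_zero) simp
    show "(\<lambda>k. dist (pt ((g ^^ k) a) y) (pt ((g ^^ k) x) y)) \<longlonglongrightarrow> 0"
      by (rule Lim_null_comparison[OF _ lim]) (simp only: real_norm_def abs_of_nonneg[OF zero_le_dist] le eventually_True)
    fix k
    show "pt ((g ^^ k) a) y \<in> unit_square" "pt ((g ^^ k) x) y \<in> unit_square"
      by (intro sq; use g01 x01 in blast)+
    show "baker_map (pt ((g ^^ Suc k) a) y) = pt ((g ^^ k) a) y"
      "baker_map (pt ((g ^^ Suc k) x) y) = pt ((g ^^ k) x) y"
      using step g01 x01 by simp_all
  qed simp_all
  then have "path_image (linepath (pt a y) (pt b y)) \<subseteq> ?W"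
    using ab by (auto simp: closed_segment_pt closed_segment_eq_real_ivl)
  moreover have "(top_of_set unit_square) interior_of ?W = {}"
  proof (rule ccontr)
    assume "\<not> ?thesis"
    from adic_dense[OF openin_interior_of this]
    obtain k u w where uw: "pt u w \<in> (top_of_set unit_square) interior_of ?W" "0 < w" "real N ^ k * w \<in> \<int>" .
    have "pt u w \<in> ?W" by (rule subsetD[OF interior_of_subset uw(1)])
    then obtain q where "q 0 = pt u w" "\<And>i. q i \<in> unit_square \<and> baker_map (q (Suc i)) = q i"
      by (auto simp: unstable_set_def)
    then show False using adic_no_backward_orbit[of q k] uw by simp
  qed
  ultimately show ?thesis
    unfolding invariant_manifold_piece_def nonwandering_square
    using ab sq[of a] finite_length_linepath by (auto simp: arc_linepath)
qed

end

subsection \<open>The rectangular hole\<close>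

context baker
begin

text \<open>In the application \<open>bnd\<close> is the expansion of 1 with every digit raised by
  one. \<open>bnd_0\<close>, from having at least two symbols, gives the rectangle positive width;
  \<open>bnd_recurrent\<close> says that the expansion does not end in zeros.\<close>

context
  fixes bnd :: "nat \<Rightarrow> nat"
  assumes bnd: "\<And>i. inner_digit (bnd i)" and bnd_0: "2 \<le> bnd 0"
    and bnd_recurrent: "\<And>k. \<exists>i\<ge>k. 2 \<le> bnd i"
begin

text \<open>\<open>low\<close> and \<open>high\<close> are the extreme values of sequences of inner
  digits, so the right side \<open>edge\<close> is the only one that can cut off some of these
  sequences.\<close>

definition "edge \<equiv> digit_value N bnd"
definition "low \<equiv> 1 / real (N - 1)"
definition "high \<equiv> real (N - 2) / real (N - 1)"

definition core :: "'a set" where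
  "core = cbox (pt low low) (pt edge high)"

definition baker_hole :: "'a set" where
  "baker_hole = unit_square - core"

lemma rect_parameters: "0 < low" "low < edge" "edge \<le> high" "high < 1" "low < high" "edge < 1"
proof -
  show "0 < low" "high < 1" "low < high"
    using N by (simp_all add: low_def high_def divide_strict_right_mono)
  show le: "edge \<le> high"
    unfolding edge_def high_def by (rule inner_digit_value_bounds(2)[OF bnd])
  then show "edge < 1" using \<open>high < 1\<close> by simp
  have "digit_value N (\<lambda>_. 1) < digit_value N bnd"
  proof (rule digit_value_lex_less[OF two_le_N])
    show "digits N bnd" using bnd by (auto simp: digits_def inner_digit_def Suc_lessD)
  qed (use bnd_0 N in \<open>auto simp: digits_def intro: exI[of _ 0]\<close>)
  then show "low < edge" using N by (simp add: low_def edge_def digit_value_const[OF two_le_N])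
qed

lemma core_subset: "core \<subseteq> unit_square"
  using rect_parameters by (auto simp: core_def mem_cbox_pt)

lemma square_diff_hole: "unit_square - baker_hole = core"
  using core_subset by (auto simp: baker_hole_def)

lemma zero_notin_core: "0 \<notin> core"
  using rect_parameters pt_mem_cbox[of 0 0 low low edge high] by (simp add: pt_0 core_def)

definition admissible :: "(int \<Rightarrow> nat) \<Rightarrow> bool" where
  "admissible w \<longleftrightarrow> (\<forall>k. inner_digit (w k) \<and> future w k \<le> edge)"

lemma admissible_good: "admissible w \<Longrightarrow> good_seq w"
  by (rule inner_seq_good) (simp add: admissible_def)

lemma admissible_in_core:
  assumes "admissible w"
  shows "code_pt w k \<in> core"
proof -
  have "inner_digit (w i)" for i using assms by (simp add: admissible_def)
  then show ?thesis
    using assms inner_digit_value_bounds[of "\<lambda>i. w (k + int i)"] inner_digit_value_bounds[of "\<lambda>i. w (k - 1 - int i)"]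
    by (simp add: core_def code_pt_def low_def high_def admissible_def future_def past_def)
qed

text \<open>The map is not injective on \<open>sing\<close>, so backward orbits can branch. In the
  core they cannot: 0 lies outside, so an orbit staying in the core avoids \<open>sing\<close>, and
  off \<open>sing\<close> the preceding strip can be read off the second coordinate.\<close>

lemma core_orbit_coded:
  assumes "full_seq w" "p 0 = code_pt w 0" and p: "\<And>k. p k \<in> core" "\<And>k. baker_map (p k) = p (k + 1)"
  shows "p k = code_pt w k \<and> code_pt w k \<in> open_strip (w k)"
proof -
  have ns: "p k \<notin> sing" for k
    using p[of k] p(1)[of "k + 1"] zero_notin_core baker_map_sing[of "p k"] by auto
  have "p k = code_pt w k"
  proof (induction k rule: int_induct[where k = 0])
    case base
    then show ?case by (rule assms(2))
  next
    case (step1 i)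
    then show ?case using code_pt_step(2)[OF assms(1), of i] ns[of i] p(2)[of i] by simp
  next
    case (step2 i)
    have "p (i - 1) \<in> unit_square - sing" using ns p(1) core_subset by blast
    then obtain j where j: "j < N" "p (i - 1) \<in> open_strip j" using square_diff_sing by blast
    obtain x y where xy: "p (i - 1) = pt x y" "0 < y" "y < 1" using j(2) by (rule open_stripE)
    have "code_pt w i = pt (real N * x - real j) ((y + real j) / real N)"
      using baker_map_open_strip[of x y j] j(2) p(2)[of "i - 1"] step2(2) xy(1) by simp
    then have *: "future w i = real N * x - real j" "real N * past w i = y + real j"
      using N by (auto simp: code_pt_def)
    have "real (w (i - 1)) + past w (i - 1) = y + real j"
      using past_rec[OF assms(1), of i] * by simp
    \<comment> \<open>Both sides are an integer plus a rest; as \<open>0 < y < 1\<close> and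
      \<open>past\<close> lies in [0, 1], the rests differ by less than 1 and the integers
      agree.\<close>
    then have eq: "w (i - 1) = j"
      using xy future_past_bounds[OF assms(1), of "i - 1"] by linarith
    then have "past w (i - 1) = y" using \<open>real (w (i - 1)) + past w (i - 1) = y + real j\<close> by simp
    moreover have "real N * future w (i - 1) = real N * x"
      using future_rec[OF assms(1), of "i - 1"] eq *(1) by simp
    then have "future w (i - 1) = x" using N by simp
    ultimately show ?case by (simp add: xy(1) code_pt_def)
  qed
  then show ?thesis using code_pt_step(1)[OF assms(1), of k] ns[of k] by simp
qed

text \<open>Since \<open>N * low > 1\<close> and \<open>N * high < N - 1\<close>, the core lies
  strictly between the spare strips. Every digit possible there is inner, even on a line shared by
  two strips.\<close>

lemma core_digit_inner:
  assumes "full_seq w" "code_pt w k \<in> core"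
  shows "inner_digit (w k)"
proof -
  have "low \<le> future w k" "future w k \<le> high"
    using assms(2) rect_parameters by (auto simp: core_def code_pt_def)
  moreover have "1 < real N * low" "real N * high < real N - 1"
    using N by (auto simp: low_def high_def field_simps of_nat_diff)
  ultimately have "1 < real N * future w k" "real N * future w k < real N - 1"
    using N by (smt (verit) mult_left_mono of_nat_0_le_iff)+
  moreover have "real N * future w k = real (w k) + future w (k + 1)" by (rule future_rec[OF assms(1)])
  ultimately have "0 < real (w k)" "real (w k) < real N - 1"
    using future_past_bounds[OF assms(1), of "k + 1"] by linarith+
  then show ?thesis unfolding inner_digit_def by linarith
qed

lemma code_pt_avoiding_iff:
  assumes "full_seq w"
  shows "code_pt w 0 \<in> avoiding_set unit_square baker_map baker_hole \<longleftrightarrow> admissible w"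
proof
  assume "code_pt w 0 \<in> avoiding_set unit_square baker_map baker_hole"
  then obtain p :: "int \<Rightarrow> 'a"
    where p: "p 0 = code_pt w 0" and core: "\<forall>k. p k \<in> core \<and> baker_map (p k) = p (k + 1)"
    unfolding avoiding_set_def square_diff_hole by blast
  have "code_pt w k \<in> core" for k
    using core_orbit_coded[of w p k, OF assms p] core by metis
  then show "admissible w"
    using core_digit_inner[OF assms] by (auto simp: admissible_def core_def code_pt_def)
next
  assume adm: "admissible w"
  show "code_pt w 0 \<in> avoiding_set unit_square baker_map baker_hole"
    unfolding avoiding_set_def square_diff_hole
    by (intro CollectI exI[of _ "code_pt w"])
      (simp add: admissible_in_core[OF adm] good_code_pt_step[OF admissible_good[OF adm]])
qed

text \<open>Both sequences are the itinerary of the same orbit in the core, through disjoint open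
  strips. Admissibility is asked of \<open>w\<close> alone, as the boundary convention compares it
  with arbitrary codes \<open>w'\<close>.\<close>

lemma code_pt_injective:
  assumes "full_seq w" "full_seq w'" "admissible w" "code_pt w 0 = code_pt w' 0"
  shows "w = w'"
proof
  fix k
  have *: "baker_map (code_pt w k) = code_pt w (k + 1)" for k
    by (rule good_code_pt_step[OF admissible_good[OF assms(3)]])
  have "code_pt w k \<in> open_strip (w k)" "code_pt w k = code_pt w' k \<and> code_pt w' k \<in> open_strip (w' k)"
    using core_orbit_coded[OF assms(1) refl admissible_in_core[OF assms(3)] *]
      core_orbit_coded[OF assms(2) assms(4) admissible_in_core[OF assms(3)] *] by blast+
  then show "w k = w' k" using open_strip_unique by metis
qed

lemma admissible_iff_lex_le:
  assumes "\<And>k. inner_digit (w k)"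
  shows "admissible w \<longleftrightarrow> (\<forall>k. lex_le (\<lambda>i. w (k + int i)) bnd)"
  using assms digit_value_le_iff_lex_le[OF _ bnd] unfolding admissible_def future_def edge_def by auto

text \<open>Digit 1 is the smallest one occurring in the core, so a sufficiently long block of 1s may
  be inserted between two admissible words: a match with the bound cannot extend across it.\<close>

lemma admissible_recurrent:
  assumes w: "admissible w"
  obtains s P where "admissible s" "0 < (P :: nat)"
    "\<And>i. - int m \<le> i \<Longrightarrow> i < int m \<Longrightarrow> s i = w i"
    "\<And>i. - int m \<le> i \<Longrightarrow> i < int m \<Longrightarrow> s (i + int P) = w i"
proof -
  \<comment> \<open>The two copies of the word will be separated by 1s at the positions
    \<open>m\<close> to \<open>m + j\<close>. A match with \<open>bnd\<close> that starts in the
    first copy is inside this gap at index \<open>j\<close>, because \<open>2 * m \<le> j\<close>,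
    and fails there as \<open>2 \<le> bnd j\<close>.\<close>
  obtain j where j: "2 * m \<le> j" "2 \<le> bnd j" using bnd_recurrent by blast
  define P where "P = 2 * m + j + 1"
  define s where "s i = (if - int m \<le> i \<and> i < int m then w i
    else if - int m \<le> i - int P \<and> i - int P < int m then w (i - int P) else 1)" for i
  have w_inner: "inner_digit (w i)" for i using w by (simp add: admissible_def)
  have w_lex: "lex_le (\<lambda>i. w (k + int i)) bnd" for k
    using w admissible_iff_lex_le[of w, OF w_inner] by blast
  have bnd_1: "1 \<le> bnd l" for l using bnd[of l] by (simp add: inner_digit_def)
  have s_inner: "inner_digit (s i)" for i using w_inner N by (simp add: s_def inner_digit_def)
  have "lex_le (\<lambda>i. s (k + int i)) bnd" for k
  proof (rule ccontr)
    assume "\<not> lex_le (\<lambda>i. s (k + int i)) bnd"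
    then obtain l where l: "\<And>i. i < l \<Longrightarrow> s (k + int i) = bnd i" "bnd l < s (k + int l)"
      unfolding not_lex_le by blast
    \<comment> \<open>A violation that lies entirely in a translate of \<open>w\<close> contradicts
      the admissibility of \<open>w\<close>.\<close>
    have no_match: False
      if "\<And>i. i \<le> l \<Longrightarrow> s (k + int i) = w (k + c + int i)" for c
    proof -
      have "\<not> lex_le (\<lambda>i. w (k + c + int i)) bnd"
        unfolding not_lex_le using l that by (intro exI[of _ l]) auto
      then show False using w_lex by blast
    qed
    have "s (k + int l) \<noteq> 1" using l(2) bnd_1[of l] by linarith
    moreover have "s k \<noteq> 1"
    proof (cases l)
      case 0
      then show ?thesis using l(2) bnd_0 by simp
    next
      case (Suc l')
      then show ?thesis using l(1)[of 0] bnd_0 by simp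
    qed
    \<comment> \<open>Both ends of a violation carry digits other than 1 and hence lie in copies of
      the word: both in the first, both in the second, or one in each.\<close>
    ultimately consider "- int m \<le> k" "k + int l < int m"
      | "- int m \<le> k - int P" "k + int l - int P < int m"
      | "- int m \<le> k" "k < int m" "- int m \<le> k + int l - int P"
      unfolding s_def by (auto split: if_splits)
    then show False
    proof cases
      case 1
      then show False by (intro no_match[of 0]) (simp add: s_def)
    next
      case 2
      then show False by (intro no_match[of "- int P"]) (auto simp: s_def P_def algebra_simps)
    next
      case 3
      then have "j < l" using j by (simp add: P_def)
      moreover have "s (k + int j) = 1" using 3 j by (simp add: s_def P_def)
      ultimately show False using l(1)[of j] j(2) by simp
    qed
  qed
  then have "admissible s" using admissible_iff_lex_le[of s, OF s_inner] by blast
  moreover have "0 < P" by (simp add: P_def)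
  moreover have "s i = w i" if "- int m \<le> i" "i < int m" for i
    using that by (simp add: s_def)
  moreover have "s (i + int P) = w i" if "- int m \<le> i" "i < int m" for i
    using that j by (simp add: s_def P_def)
  ultimately show thesis by (rule that)
qed

text \<open>The sequence \<open>s\<close> agrees with \<open>w\<close> around time 0 and again
  around time \<open>P\<close>, so its orbit stays in the core and returns close to the given point.
  Passing to nonwandering points thus loses no coded point.\<close>

lemma code_pt_nonwandering_iff:
  assumes "full_seq w"
  shows "code_pt w 0 \<in> nonwandering (avoiding_set unit_square baker_map baker_hole) baker_map \<longleftrightarrow> admissible w"
    (is "_ \<in> nonwandering ?X _ \<longleftrightarrow> _")
proof
  assume "code_pt w 0 \<in> nonwandering ?X baker_map"
  then show "admissible w" using code_pt_avoiding_iff[OF assms] by (simp add: nonwandering_def)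
next
  assume w: "admissible w"
  have "\<exists>k>0. (baker_map ^^ k) ` (?X \<inter> U) \<inter> U \<noteq> {}" if U: "open U" "code_pt w 0 \<in> U" for U
  proof -
    obtain \<epsilon> where \<epsilon>: "0 < \<epsilon>" "ball (code_pt w 0) \<epsilon> \<subseteq> U" using U by (auto elim: openE)
    obtain m where m: "2 / real N ^ m < \<epsilon>" using power_small[OF \<epsilon>(1)] .
    obtain s P where s: "admissible s" "0 < P"
      "\<And>i. - int m \<le> i \<Longrightarrow> i < int m \<Longrightarrow> s i = w i"
      "\<And>i. - int m \<le> i \<Longrightarrow> i < int m \<Longrightarrow> s (i + int P) = w i"
      using admissible_recurrent[OF w] by metis
    have good: "good_seq s" using s(1) by (rule admissible_good)
    then have full: "full_seq s" "full_seq (\<lambda>i. s (i + int P))" by (auto simp: good_seq_def full_seq_def)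
    have "dist (code_pt s 0) (code_pt w 0) \<le> 2 / real N ^ m"
      by (intro code_pt_prefix full assms s(3))
    then have "code_pt s 0 \<in> U" using \<epsilon>(2) m by (auto simp: dist_commute)
    moreover have "code_pt s 0 \<in> ?X" using code_pt_avoiding_iff[OF full(1)] s(1) by blast
    moreover have "(baker_map ^^ P) (code_pt s 0) \<in> U"
    proof -
      have "(baker_map ^^ P) (code_pt s 0) = code_pt (\<lambda>i. s (i + int P)) 0"
        by (simp add: good_code_pt_iterate[OF good] code_pt_shift)
      moreover have "dist (code_pt (\<lambda>i. s (i + int P)) 0) (code_pt w 0) \<le> 2 / real N ^ m"
        by (intro code_pt_prefix full assms s(4))
      ultimately show ?thesis using \<epsilon>(2) m by (auto simp: dist_commute)
    qed
    ultimately show ?thesis using s(2) by blast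
  qed
  then show "code_pt w 0 \<in> nonwandering ?X baker_map"
    using code_pt_avoiding_iff[OF assms] w by (simp add: nonwandering_def)
qed

lemma hole_baker_hole: "hole 2 unit_square baker_hole"
  unfolding baker_hole_def core_def using rect_parameters by (intro hole_rect_complement) auto

lemma baker_hole_boundary:
  "\<exists>\<Gamma>. finite \<Gamma> \<and> closure baker_hole - baker_hole = (\<Union>\<gamma>\<in>\<Gamma>. path_image \<gamma>) \<and>
    (\<forall>\<gamma>\<in>\<Gamma>. invariant_manifold_piece unit_square baker_map \<gamma>)"
proof -
  let ?\<Gamma> = "{linepath (pt low low) (pt low high), linepath (pt edge low) (pt edge high),
    linepath (pt low low) (pt edge low), linepath (pt low high) (pt edge high)}"
  have inner: "inner_digit 1" "inner_digit (N - 2)" using N by (auto simp: inner_digit_def)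
  have "closure baker_hole - baker_hole = (\<Union>\<gamma>\<in>?\<Gamma>. path_image \<gamma>)"
    unfolding baker_hole_def core_def using rect_parameters
    by (subst rect_complement_boundary) (auto simp only: rect_boundary_eq_segments)
  moreover have "low = digit_value N (\<lambda>_. 1)"
    using N by (simp add: low_def digit_value_const[OF two_le_N])
  then have "invariant_manifold_piece unit_square baker_map (linepath (pt low low) (pt low high))"
    using vertical_piece[of "\<lambda>_. 1" low high] inner rect_parameters by simp
  moreover have "invariant_manifold_piece unit_square baker_map (linepath (pt edge low) (pt edge high))"
    unfolding edge_def using rect_parameters by (intro vertical_piece bnd) auto
  moreover have "invariant_manifold_piece unit_square baker_map (linepath (pt low low) (pt edge low))"
    using rect_parameters by (intro horizontal_piece[OF inner(1)]) (auto simp: low_def)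
  moreover have "invariant_manifold_piece unit_square baker_map (linepath (pt low high) (pt edge high))"
    using rect_parameters by (intro horizontal_piece[OF inner(2)]) (auto simp: high_def)
  ultimately show ?thesis
    by (intro exI[of _ ?\<Gamma>]) blast
qed

context
  fixes pos :: "nat \<Rightarrow> nat"
  assumes pos: "bij_betw pos {..<N} {..<N}"
begin

lemma exclusion_system_baker:
  "exclusion_system 2 unit_square baker_map sing {..<N} (\<lambda>j. strip (pos j)) baker_hole"
proof -
  have "submanifold 2 unit_square"
    using submanifold_pt_cbox[of 0 1 0 1] by (simp add: unit_square_def numeral_2_eq_2)
  then show ?thesis
    unfolding exclusion_system_def nonwandering_square
    using piecewise_local_diffeo_baker generating_markov_partition_strips[OF pos] hole_baker_hole
    by (simp add: unit_square_def compact_cbox)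
qed

text \<open>By \<open>unique\<close> an admissible code shares its point with no other code, so the
  boundary convention keeps all of them.\<close>

lemma exclusion_shift_baker:
  "exclusion_shift unit_square baker_map sing {..<N} (\<lambda>j. strip (pos j)) baker_hole =
    {t. full_seq t \<and> admissible (\<lambda>k. pos (t k))}"
proof -
  have full: "full_seq (\<lambda>k. pos (t k))" if "full_seq t" for t
    using that pos by (auto simp: full_seq_def bij_betw_def)
  have unique: "t' = t" if "full_seq t" "full_seq t'" "admissible (\<lambda>k. pos (t k))"
    "code_pt (\<lambda>k. pos (t' k)) 0 = code_pt (\<lambda>k. pos (t k)) 0" for t t'
  proof -
    have "pos (t k) = pos (t' k)" for k
      using code_pt_injective[OF full[OF that(1)] full[OF that(2)] that(3)] that(4) by metis
    then show ?thesis
      using that(1,2) pos by (auto simp: fun_eq_iff bij_betw_def inj_on_def full_seq_def)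
  qed
  show ?thesis
    unfolding exclusion_shift_def Let_def nonwandering_square coding_sft_full[OF pos]
    using unique
    by (auto simp: coding_map_strips[OF pos] code_pt_nonwandering_iff[OF full])
qed

end

end

end

theorem theorem3p5:
  fixes \<beta> :: real
  assumes "1 < \<beta>"
  shows "rectangle_exclusion_shift (beta_shift \<beta>)"
proof -
  define n where "n = beta_size \<beta>"
  define N where "N = n + 2"
  define bnd where "bnd i = Suc (quasi_greedy \<beta> i)" for i
  \<comment> \<open>Label \<open>j < n\<close> occupies strip \<open>j + 1\<close>; the surplus
    labels \<open>n\<close> and \<open>n + 1\<close> get the spare strips \<open>N - 1\<close> and
    0.\<close>
  define pos where "pos j = (if Suc j < N then Suc j else 0)" for j
  have n: "2 \<le> n" unfolding n_def by (rule beta_size_ge_2[OF assms])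
  interpret baker "axis 1 1 :: real ^ 5" "axis 2 1 :: real ^ 5" N
    by standard (use n in \<open>auto simp: N_def axis_in_Basis_iff axis_eq_axis\<close>)
  have inner_digit_iff: "inner_digit j \<longleftrightarrow> 0 < j \<and> j \<le> n" for j
    unfolding inner_digit_def by (auto simp: N_def)
  have bnd: "inner_digit (bnd i)" for i
    using quasi_greedy_less[OF assms, of i] by (simp add: inner_digit_iff bnd_def n_def Suc_le_eq)
  have bnd_0: "2 \<le> bnd 0"
    using n by (simp add: bnd_def quasi_greedy_0[OF assms] n_def)
  have bnd_recurrent: "\<exists>i\<ge>k. 2 \<le> bnd i" for k
    using quasi_greedy_nonzero[OF assms, of k] by (force simp: bnd_def)
  have pos: "bij_betw pos {..<N} {..<N}"
  proof -
    have "inj_on pos {..<N}" by (auto simp: inj_on_def pos_def split: if_splits)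
    moreover have "pos ` {..<N} \<subseteq> {..<N}" using n by (auto simp: pos_def N_def)
    ultimately show ?thesis by (simp add: bij_betw_def endo_inj_surj)
  qed
  note baker_facts = bnd bnd_0 bnd_recurrent
  have "beta_shift \<beta> = {t. full_seq t \<and> admissible bnd (\<lambda>k. pos (t k))}"
  proof (intro set_eqI iffI; unfold mem_Collect_eq)
    have key: "admissible bnd (\<lambda>k. pos (t k)) \<longleftrightarrow> (\<forall>k. lex_le (\<lambda>i. t (k + int i)) (quasi_greedy \<beta>))"
      if t: "\<And>k. t k < n" for t
    proof -
      have pos_t: "pos (t k) = Suc (t k)" for k using t[of k] by (simp add: pos_def N_def)
      have "admissible bnd (\<lambda>k. Suc (t k)) \<longleftrightarrow> (\<forall>k. lex_le (\<lambda>i. Suc (t (k + int i))) bnd)"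
        using t by (intro admissible_iff_lex_le[OF baker_facts]) (simp add: inner_digit_iff Suc_le_eq)
      moreover have "lex_le (\<lambda>i. Suc (s i)) bnd \<longleftrightarrow> lex_le s (quasi_greedy \<beta>)" for s
        by (simp add: lex_le_def bnd_def fun_eq_iff)
      ultimately show ?thesis unfolding pos_t by simp
    qed
    fix t
    {
      assume "t \<in> beta_shift \<beta>"
      then have lex: "\<forall>k. lex_le (\<lambda>i. t (k + int i)) (quasi_greedy \<beta>)"
        unfolding beta_shift_eq[OF assms] by simp
      have t: "t k < n" for k
        using lex_le_head[OF lex[rule_format, of k]] quasi_greedy_less[OF assms, of 0] by (simp add: n_def)
      then have "t k < N" for k unfolding N_def by (rule trans_less_add1)
      then have "full_seq t" unfolding full_seq_def by blast
      then show "full_seq t \<and> admissible bnd (\<lambda>k. pos (t k))" using key[of t] t lex by blast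
    next
      assume t: "full_seq t \<and> admissible bnd (\<lambda>k. pos (t k))"
      \<comment> \<open>The surplus labels sit on the spare strips, whose digits are not inner, and
        so cannot occur.\<close>
      have "t k < n" for k
      proof -
        have "inner_digit (pos (t k))" using t by (simp add: admissible_def[OF baker_facts])
        then show ?thesis by (auto simp: inner_digit_iff pos_def split: if_splits)
      qed
      then show "t \<in> beta_shift \<beta>"
        unfolding beta_shift_eq[OF assms] using key[of t] t by blast
    }
  qed
  moreover have "rectangle_exclusion_shift
      (exclusion_shift unit_square baker_map sing {..<N} (\<lambda>j. strip (pos j)) (baker_hole bnd))"
    unfolding rectangle_exclusion_shift_def
    by (rule exI)+ (rule conjI[OF exclusion_system_baker[OF baker_facts pos]
        conjI[OF baker_hole_boundary[OF baker_facts] refl]])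
  ultimately show ?thesis
    by (simp only: exclusion_shift_baker[OF baker_facts pos])
qed

end
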